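(* Let $\ell_H\ge1$, let $\hat L_1,\dots,\hat L_{\ell_H}$ be operators on an $n$-qubit system register, let $\Omega_1,\dots,\Omega_{\ell_H}\in\mathbb{R}$, and let $\hat H=\sum_{s=1}^{\ell_H}\Omega_s\hat L_s$. Suppose that for each $s$ there is a unitary $W_s$ acting on the system register and $t$ ancilla qubits that is an $(\alpha_s,t,\epsilon_s)$ block encoding of $\hat L_s$. Put $$\alpha=\sum_{s=1}^{\ell_H}|\Omega_s|\,\alpha_s,\qquad \epsilon_{\mathrm{LCU}}=\frac1\alpha\sum_{s=1}^{\ell_H}|\Omega_s|\,\alpha_s\,\epsilon_s,\qquad \mathfrak a_H=\lceil\log_2\ell_H\rceil,$$ and assume $\alpha>0$. Then there exists a unitary $W$, acting on the system and $\mathfrak a_H+t$ ancilla qubits ($\mathfrak a_H$ selector qubits together with the $t$ ancillas of the $W_s$, which are reused across all branches $s$), that is an $(\alpha,\mathfrak a_H+t,\epsilon_{\mathrm{LCU}})$ block encoding of $\hat H$, i.e. $$\Bigl\|\Pi\Bigl[(\langle 0^{\mathfrak a_H+t}|\otimes I)\,W\,(|0^{\mathfrak a_H+t}\rangle\otimes I)-\frac{\hat H}{\alpha}\Bigr]\Pi\Bigr\|\le\epsilon_{\mathrm{LCU}},$$ where $\Pi$ is the projector onto the working subspace. Moreover $W$ can be realized by a circuit whose depth satisfies $$\mathrm{depth}(W)=\mathcal O\Bigl(\mathrm{depth}(U_{\mathrm{prep}})+\sum_{s=1}^{\ell_H}\mathrm{depth}(\text{c-}W_s)\Bigr).$$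
   Context: Block encoding: fix a working subspace of the $n$-qubit system space $(\mathbb{C}^2)^{\otimes n}$ (in the source, a fixed particle-number sector $\mathcal H_{N_e}$) with orthogonal projector $\Pi$. For $\alpha>0$, $t\in\mathbb{N}$, $\epsilon\ge0$, a unitary $W$ on $(\mathbb{C}^2)^{\otimes t}\otimes(\mathbb{C}^2)^{\otimes n}$ is an $(\alpha,t,\epsilon)$ block encoding of an operator $\hat A$ on the system if $\|\Pi[(\langle 0^t|\otimes I)W(|0^t\rangle\otimes I)-\hat A/\alpha]\Pi\|\le\epsilon$ in operator norm. The labels $s\in\{1,\dots,\ell_H\}$ are identified with distinct computational basis states $|s\rangle$ of the selector register of $\mathfrak a_H$ qubits. $U_{\mathrm{prep}}$ denotes the selector state-preparation unitary, with $U_{\mathrm{prep}}|0^{\mathfrak a_H}\rangle=\alpha^{-1/2}\sum_{s=1}^{\ell_H}\sqrt{|\Omega_s|\alpha_s}\,|s\rangle$. $\text{c-}W_s$ denotes the selector-controlled implementation of $W_s$: the unitary that applies $e^{i\phi_s}W_s$ to the $t$ ancillas and the system when the selector is in $|s\rangle$ and acts as the identity on selector states orthogonal to $|s\rangle$, where $\Omega_s=|\Omega_s|e^{i\phi_s}$ (the coefficient sign is absorbed as a branch phase). $\mathrm{depth}(\cdot)$ is the circuit depth of a given circuit implementation of the unitary over a fixed gate set, and the constant in $\mathcal O$ is absolute.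
   Formalization: The fixed gate set is assumed to be closed under adjoints (inverses); without this the depth bound can fail, since the inverse of the state-preparation circuit need not be realizable over the gate set. *)

theory Defs
  imports "Jordan_Normal_Form.Schur_Decomposition" "HOL-Analysis.L2_Norm"
begin

(* Operators on m qubits are complex matrices in carrier_mat (2 ^ m) (2 ^ m).  Computational
   basis states are indexed by 0, ..., 2 ^ m - 1, qubit 0 being the most significant bit, so that
   the first factor of a tensor product consists of the qubits with the smallest numbers. *)

section \<open>Operators\<close>

definition kron :: "complex mat \<Rightarrow> complex mat \<Rightarrow> complex mat" where
  "kron A B = mat (dim_row A * dim_row B) (dim_col A * dim_col B)
     (\<lambda>(i, j). A $$ (i div dim_row B, j div dim_col B) * B $$ (i mod dim_row B, j mod dim_col B))"

definition unitary_mat :: "nat \<Rightarrow> complex mat \<Rightarrow> bool" where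
  "unitary_mat N U \<longleftrightarrow> U \<in> carrier_mat N N \<and> mat_adjoint U * U = 1\<^sub>m N \<and> U * mat_adjoint U = 1\<^sub>m N"

definition l2norm :: "complex vec \<Rightarrow> real" where
  "l2norm v = L2_set (\<lambda>i. cmod (v $ i)) {..<dim_vec v}"

definition opnorm :: "complex mat \<Rightarrow> real" where
  "opnorm A = (SUP v \<in> {v \<in> carrier_vec (dim_col A). l2norm v \<le> 1}. l2norm (A *\<^sub>v v))"

definition orth_projector_onto :: "nat \<Rightarrow> complex vec set \<Rightarrow> complex mat \<Rightarrow> bool" where
  "orth_projector_onto N S P \<longleftrightarrow>
     VectorSpace.subspace class_ring S (module_vec TYPE(complex) N) \<and> P \<in> carrier_mat N N \<and>
     (\<forall>v \<in> carrier_vec N. P *\<^sub>v v \<in> S \<and> (\<forall>w \<in> S. (v - P *\<^sub>v v) \<bullet>c w = 0))"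

definition lincomb_mat :: "nat \<Rightarrow> nat \<Rightarrow> (nat \<Rightarrow> real) \<Rightarrow> (nat \<Rightarrow> complex mat) \<Rightarrow> complex mat" where
  "lincomb_mat N l \<Omega> L = mat N N (\<lambda>ij. \<Sum>s = 1..l. complex_of_real (\<Omega> s) * L s $$ ij)"


section \<open>Block encodings\<close>

(* The state |0^t> as a column; its adjoint is the row <0^t|. *)
definition ket0 :: "nat \<Rightarrow> complex mat" where
  "ket0 t = mat (2 ^ t) 1 (\<lambda>(i, j). if i = 0 then 1 else 0)"

definition ancilla_block :: "nat \<Rightarrow> nat \<Rightarrow> complex mat \<Rightarrow> complex mat" where
  "ancilla_block n t W =
     kron (mat_adjoint (ket0 t)) (1\<^sub>m (2 ^ n)) * W * kron (ket0 t) (1\<^sub>m (2 ^ n))"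

definition block_encoding ::
  "nat \<Rightarrow> complex mat \<Rightarrow> real \<Rightarrow> nat \<Rightarrow> real \<Rightarrow> complex mat \<Rightarrow> complex mat \<Rightarrow> bool" where
  "block_encoding n P \<alpha> t \<epsilon> W A \<longleftrightarrow>
     0 < \<alpha> \<and> 0 \<le> \<epsilon> \<and> unitary_mat (2 ^ (t + n)) W \<and> A \<in> carrier_mat (2 ^ n) (2 ^ n) \<and>
     opnorm (P * (ancilla_block n t W - complex_of_real (1 / \<alpha>) \<cdot>\<^sub>m A) * P) \<le> \<epsilon>"


section \<open>State preparation and selection\<close>

(* The basis state of the selector register that carries the label s is number sel s. *)
definition selector_labels :: "nat \<Rightarrow> nat \<Rightarrow> (nat \<Rightarrow> nat) \<Rightarrow> bool" where
  "selector_labels a l sel \<longleftrightarrow> inj_on sel {1..l} \<and> (\<forall>s \<in> {1..l}. sel s < 2 ^ a)"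

definition prep_unitary ::
  "nat \<Rightarrow> nat \<Rightarrow> (nat \<Rightarrow> nat) \<Rightarrow> (nat \<Rightarrow> real) \<Rightarrow> (nat \<Rightarrow> real) \<Rightarrow> real \<Rightarrow> complex mat \<Rightarrow> bool" where
  "prep_unitary a l sel \<Omega> \<alpha>s \<alpha> U \<longleftrightarrow>
     unitary_mat (2 ^ a) U \<and>
     U *\<^sub>v unit_vec (2 ^ a) 0 =
       complex_of_real (1 / sqrt \<alpha>) \<cdot>\<^sub>v
         vec (2 ^ a) (\<lambda>i. \<Sum>s = 1..l.
           complex_of_real (sqrt (\<bar>\<Omega> s\<bar> * \<alpha>s s)) * (if i = sel s then 1 else 0))"

definition basis_projector :: "nat \<Rightarrow> nat \<Rightarrow> complex mat" where
  "basis_projector a k = mat (2 ^ a) (2 ^ a) (\<lambda>(i, j). if i = k \<and> j = k then 1 else 0)"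

(* |k><k| (x) e^{i phi} V + (I - |k><k|) (x) I *)
definition controlled :: "nat \<Rightarrow> nat \<Rightarrow> real \<Rightarrow> complex mat \<Rightarrow> complex mat" where
  "controlled a k \<phi> V =
     kron (basis_projector a k) (cis \<phi> \<cdot>\<^sub>m V) +
     kron (1\<^sub>m (2 ^ a) - basis_projector a k) (1\<^sub>m (dim_row V))"


section \<open>Circuits\<close>

(* Closure under adjoints makes the inverse of a circuit a circuit of the same depth. *)
definition gate_set :: "complex mat set \<Rightarrow> bool" where
  "gate_set G \<longleftrightarrow> (\<forall>g \<in> G. (\<exists>k \<ge> 1. unitary_mat (2 ^ k) g) \<and> mat_adjoint g \<in> G)"

(* A placed gate (g, qs) acts on the qubits qs, the first of which is the most significant one
   for g.  The gates of a layer act on disjoint sets of qubits; a circuit is a list of layers,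
   the first of which is applied first. *)
type_synonym placed_gate = "complex mat \<times> nat list"
type_synonym layer = "placed_gate list"
type_synonym circuit = "layer list"

definition qubit :: "nat \<Rightarrow> nat \<Rightarrow> nat \<Rightarrow> bool" where
  "qubit m i q = bit i (m - 1 - q)"

definition subindex :: "nat \<Rightarrow> nat list \<Rightarrow> nat \<Rightarrow> nat" where
  "subindex m qs i =
     (\<Sum>k < length qs. of_bool (qubit m i (qs ! k)) * 2 ^ (length qs - 1 - k))"

definition placed_gate_mat :: "nat \<Rightarrow> placed_gate \<Rightarrow> complex mat" where
  "placed_gate_mat m = (\<lambda>(g, qs). mat (2 ^ m) (2 ^ m) (\<lambda>(i, j).
     if \<forall>q < m. q \<notin> set qs \<longrightarrow> qubit m i q = qubit m j q
     then g $$ (subindex m qs i, subindex m qs j) else 0))"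

primrec layer_mat :: "nat \<Rightarrow> layer \<Rightarrow> complex mat" where
  "layer_mat m [] = 1\<^sub>m (2 ^ m)"
| "layer_mat m (p # ps) = layer_mat m ps * placed_gate_mat m p"

primrec circuit_mat :: "nat \<Rightarrow> circuit \<Rightarrow> complex mat" where
  "circuit_mat m [] = 1\<^sub>m (2 ^ m)"
| "circuit_mat m (ly # C) = circuit_mat m C * layer_mat m ly"

(* Distinctness of the concatenation says both that every gate acts on distinct qubits and that
   different gates of the layer act on disjoint sets of qubits. *)
definition layer_over :: "complex mat set \<Rightarrow> nat \<Rightarrow> layer \<Rightarrow> bool" where
  "layer_over G m ly \<longleftrightarrow>
     (\<forall>(g, qs) \<in> set ly.
        g \<in> G \<and> g \<in> carrier_mat (2 ^ length qs) (2 ^ length qs) \<and> set qs \<subseteq> {..<m}) \<and>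
     distinct (concat (map snd ly))"

definition implements :: "complex mat set \<Rightarrow> nat \<Rightarrow> circuit \<Rightarrow> complex mat \<Rightarrow> bool" where
  "implements G m C U \<longleftrightarrow> (\<forall>ly \<in> set C. layer_over G m ly) \<and> circuit_mat m C = U"

definition depth :: "circuit \<Rightarrow> nat" where
  "depth C = length C"

end

theory Submission
  imports Defs
begin

text \<open>
  With the preparation unitary \<open>U\<close>, \<open>K = U \<otimes> I\<close> and \<open>S\<close> the product of the controlled \<open>W\<^sub>s\<close>,
  take \<open>W = K\<^sup>\<dagger> S K\<close>.  The factor \<open>S\<close> is block diagonal in the selector basis, so the top left
  block of \<open>W\<close> is the average of the blocks of \<open>S\<close> with weights
  \<open>\<bar>U(x, 0)\<bar>\<^sup>2 = \<bar>\<Omega>\<^sub>s\<bar> \<alpha>\<^sub>s / \<alpha>\<close> at \<open>x = sel s\<close>.  The branch phases turn \<open>\<bar>\<Omega>\<^sub>s\<bar>\<close> into \<open>\<Omega>\<^sub>s\<close>, and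
  the error bound is the triangle inequality.  The circuit runs the preparation, the controlled
  \<open>W\<^sub>s\<close> in turn, and the inverse preparation, whence the constant 2.
\<close>

section \<open>Entrywise matrix algebra\<close>

lemma index_mult_mat_sum:
  assumes "A \<in> carrier_mat n k" "B \<in> carrier_mat k m" "i < n" "j < m"
  shows "(A * B) $$ (i, j) = (\<Sum>r<k. A $$ (i, r) * B $$ (r, j))"
  using assms by (simp add: scalar_prod_def atLeast0LessThan)

lemma mult_add_less:
  assumes "x < N" "i < (M :: nat)"
  shows "x * M + i < N * M"
proof -
  have "x * M + i < Suc x * M" using assms by simp
  also have "\<dots> \<le> N * M" using assms by (intro mult_le_mono1) simp
  finally show ?thesis .
qed

text \<open>A basis index of a two-part register is \<open>x * M + i\<close>, with \<open>x\<close>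
  the more significant part. Matrix products over such a register are split this way in the tensor
  and block calculations below.\<close>

lemma sum_lessThan_mult:
  fixes f :: "nat \<Rightarrow> 'a :: comm_monoid_add"
  shows "(\<Sum>k<N * M. f k) = (\<Sum>x<N. \<Sum>i<M. f (x * M + i))"
proof -
  have "(\<Sum>k<N * M. f k) = (\<Sum>(x, i)\<in>{..<N} \<times> {..<M}. f (x * M + i))"
    by (rule sum.reindex_bij_witness[of _ "\<lambda>(x, i). x * M + i" "\<lambda>k. (k div M, k mod M)"])
       (auto simp: mult_add_less less_mult_imp_div_less, (metis mod_less_divisor mult_0_right not_gr_zero less_nat_zero_code)+)
  then show ?thesis by (simp add: sum.cartesian_product)
qed

lemma dim_mat_adjoint [simp]: "dim_row (mat_adjoint A) = dim_col A" "dim_col (mat_adjoint A) = dim_row A"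
  by (auto simp: mat_adjoint_def)

lemma mat_adjoint_carrier [simp]:
  "A \<in> carrier_mat n m \<Longrightarrow> mat_adjoint A \<in> carrier_mat m n"
  by auto

lemma index_mat_adjoint [simp]:
  "i < dim_col A \<Longrightarrow> j < dim_row A \<Longrightarrow> mat_adjoint A $$ (i, j) = cnj (A $$ (j, i))"
  by (simp add: mat_adjoint_def mat_of_rows_index)

lemma mat_adjoint_mult:
  fixes A B :: "complex mat"
  assumes "A \<in> carrier_mat n k" "B \<in> carrier_mat k m"
  shows "mat_adjoint (A * B) = mat_adjoint B * mat_adjoint A"
proof (intro eq_matI)
  fix i j
  assume "i < dim_row (mat_adjoint B * mat_adjoint A)" "j < dim_col (mat_adjoint B * mat_adjoint A)"
  with assms have i: "i < m" and j: "j < n" by auto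
  have "mat_adjoint (A * B) $$ (i, j) = (\<Sum>r<k. cnj (B $$ (r, i)) * cnj (A $$ (j, r)))"
    using assms i j by (simp add: index_mult_mat_sum[OF assms] mult.commute del: index_mult_mat(1))
  also have "\<dots> = (\<Sum>r<k. mat_adjoint B $$ (i, r) * mat_adjoint A $$ (r, j))"
    using assms i j by (intro sum.cong) auto
  also have "\<dots> = (mat_adjoint B * mat_adjoint A) $$ (i, j)"
    using assms i j by (subst index_mult_mat_sum[of _ m k _ n]) auto
  finally show "mat_adjoint (A * B) $$ (i, j) = (mat_adjoint B * mat_adjoint A) $$ (i, j)" .
qed (use assms in auto)

lemma mat_adjoint_one [simp]: "mat_adjoint (1\<^sub>m n :: complex mat) = 1\<^sub>m n"
  by (intro eq_matI) auto

lemma mat_adjoint_adjoint [simp]: "mat_adjoint (mat_adjoint A) = (A :: complex mat)"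
  by (intro eq_matI) auto

section \<open>Unitary matrices\<close>

lemma unitary_matD:
  assumes "unitary_mat N U"
  shows "U \<in> carrier_mat N N" "mat_adjoint U * U = 1\<^sub>m N" "U * mat_adjoint U = 1\<^sub>m N"
  using assms by (auto simp: unitary_mat_def)

lemma unitary_mat_one: "unitary_mat N (1\<^sub>m N)"
  by (simp add: unitary_mat_def)

lemma unitary_mat_adjoint: "unitary_mat N U \<Longrightarrow> unitary_mat N (mat_adjoint U)"
  by (simp add: unitary_mat_def)

lemma unitary_mat_mult:
  assumes "unitary_mat N U" "unitary_mat N V"
  shows "unitary_mat N (U * V)"
proof -
  note U = unitary_matD[OF assms(1)] and V = unitary_matD[OF assms(2)]
  have adj: "mat_adjoint (U * V) = mat_adjoint V * mat_adjoint U"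
    using U(1) V(1) by (rule mat_adjoint_mult)
  have "mat_adjoint (U * V) * (U * V) = mat_adjoint V * ((mat_adjoint U * U) * V)"
    unfolding adj using U(1) V(1) by (simp add: assoc_mult_mat[of _ N N _ N _ N] mult_carrier_mat[of _ N N _ N])
  moreover have "U * V * mat_adjoint (U * V) = U * ((V * mat_adjoint V) * mat_adjoint U)"
    unfolding adj using U(1) V(1) by (simp add: assoc_mult_mat[of _ N N _ N _ N] mult_carrier_mat[of _ N N _ N])
  ultimately show ?thesis using U V by (simp add: unitary_mat_def)
qed

text \<open>The adjoint carries the conjugate phase \<open>cis (- \<phi>)\<close>, and the two
  phases cancel.\<close>

lemma unitary_mat_cis_smult:
  assumes "unitary_mat N U"
  shows "unitary_mat N (cis \<phi> \<cdot>\<^sub>m U)"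
proof -
  note U = unitary_matD[OF assms]
  have adj: "mat_adjoint (cis \<phi> \<cdot>\<^sub>m U) = cis (- \<phi>) \<cdot>\<^sub>m mat_adjoint U"
    by (intro eq_matI) (auto simp: cis_cnj)
  have "cis \<phi> \<cdot>\<^sub>m (cis (- \<phi>) \<cdot>\<^sub>m 1\<^sub>m N) = 1\<^sub>m N" "cis (- \<phi>) \<cdot>\<^sub>m (cis \<phi> \<cdot>\<^sub>m 1\<^sub>m N) = 1\<^sub>m N"
    by (intro eq_matI; auto simp: cis_mult simp flip: mult.assoc)+
  then show ?thesis
    using U by (simp add: unitary_mat_def adj mult_smult_assoc_mat[of _ N N _ N]
      mult_smult_distrib[of _ N N _ N])
qed

section \<open>Tensor products and block diagonal matrices\<close>

lemma dim_kron [simp]: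
  "dim_row (kron A B) = dim_row A * dim_row B" "dim_col (kron A B) = dim_col A * dim_col B"
  by (auto simp: kron_def)

lemma kron_carrier [simp]:
  "A \<in> carrier_mat n m \<Longrightarrow> B \<in> carrier_mat k l \<Longrightarrow> kron A B \<in> carrier_mat (n * k) (m * l)"
  by auto

lemma index_kron:
  assumes "i < dim_row A * dim_row B" "j < dim_col A * dim_col B"
  shows "kron A B $$ (i, j) =
    A $$ (i div dim_row B, j div dim_col B) * B $$ (i mod dim_row B, j mod dim_col B)"
  using assms by (simp add: kron_def)

text \<open>The bound \<open>i < n * m\<close> excludes \<open>m = 0\<close>, the case in which
  \<open>i mod m\<close> would be \<open>i\<close> itself.\<close>

lemma mult_pos_imp_mod_less: "i < n * m \<Longrightarrow> i mod m < (m :: nat)"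
  by (cases m) auto

text \<open>Mixed-product rule: the summation index splits into a pair, and the double sum factors
  into one sum per tensor factor.\<close>

lemma kron_mult:
  assumes "A \<in> carrier_mat n k" "B \<in> carrier_mat k m" "C \<in> carrier_mat n' k'" "D \<in> carrier_mat k' m'"
  shows "kron A C * kron B D = kron (A * B) (C * D)"
proof (intro eq_matI)
  fix i j assume "i < dim_row (kron (A * B) (C * D))" "j < dim_col (kron (A * B) (C * D))"
  with assms have i: "i < n * n'" and j: "j < m * m'" by auto
  have ik: "i div n' < n" "i mod n' < n'" and jk: "j div m' < m" "j mod m' < m'"
    using i j by (auto simp: less_mult_imp_div_less mult_pos_imp_mod_less)
  have "(kron A C * kron B D) $$ (i, j) =
      (\<Sum>r<k * k'. kron A C $$ (i, r) * kron B D $$ (r, j))"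
    using assms i j by (intro index_mult_mat_sum) auto
  also have "\<dots> = (\<Sum>x<k. \<Sum>y<k'. (A $$ (i div n', x) * B $$ (x, j div m')) *
      (C $$ (i mod n', y) * D $$ (y, j mod m')))"
    unfolding sum_lessThan_mult
    using assms i j by (intro sum.cong) (auto simp: index_kron mult_add_less)
  also have "\<dots> = (A * B) $$ (i div n', j div m') * (C * D) $$ (i mod n', j mod m')"
    by (simp add: index_mult_mat_sum[OF assms(1,2) ik(1) jk(1)]
      index_mult_mat_sum[OF assms(3,4) ik(2) jk(2)] sum_product del: index_mult_mat(1))
  also have "\<dots> = kron (A * B) (C * D) $$ (i, j)"
    using assms i j by (simp add: index_kron del: index_mult_mat(1))
  finally show "(kron A C * kron B D) $$ (i, j) = kron (A * B) (C * D) $$ (i, j)" .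
qed (use assms in auto)

lemma kron_one: "kron (1\<^sub>m n) (1\<^sub>m m) = 1\<^sub>m (n * m)"
proof (intro eq_matI)
  fix i j assume "i < dim_row (1\<^sub>m (n * m) :: complex mat)" "j < dim_col (1\<^sub>m (n * m) :: complex mat)"
  then have ij: "i < n * m" "j < n * m" by auto
  have "(i div m = j div m \<and> i mod m = j mod m) = (i = j)"
    by (metis div_mult_mod_eq)
  then show "kron (1\<^sub>m n) (1\<^sub>m m) $$ (i, j) = (1\<^sub>m (n * m) :: complex mat) $$ (i, j)"
    using ij by (auto simp: index_kron less_mult_imp_div_less mult_pos_imp_mod_less)
qed auto

lemma mat_adjoint_kron: "mat_adjoint (kron A B) = kron (mat_adjoint A) (mat_adjoint B)"
  by (intro eq_matI) (auto simp: index_kron less_mult_imp_div_less mult_pos_imp_mod_less)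

lemma unitary_mat_kron:
  assumes "unitary_mat N U" "unitary_mat M V"
  shows "unitary_mat (N * M) (kron U V)"
proof -
  note U = unitary_matD[OF assms(1)] and V = unitary_matD[OF assms(2)]
  show ?thesis
    using U V by (simp add: unitary_mat_def mat_adjoint_kron kron_mult[of _ N N _ N _ M M _ M] kron_one)
qed

text \<open>The selector register is the more significant one, so \<open>i div M\<close> is its
  basis state, and \<open>D x\<close> acts on the remaining register while the selector is in state
  \<open>x\<close>. Products, adjoints and unitarity are then handled block by block.\<close>

definition block_diag :: "nat \<Rightarrow> nat \<Rightarrow> (nat \<Rightarrow> complex mat) \<Rightarrow> complex mat" where
  "block_diag N M D = mat (N * M) (N * M)
     (\<lambda>(i, j). if i div M = j div M then D (i div M) $$ (i mod M, j mod M) else 0)"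

lemma block_diag_carrier [simp]: "block_diag N M D \<in> carrier_mat (N * M) (N * M)"
  by (simp add: block_diag_def)

lemma dim_block_diag [simp]:
  "dim_row (block_diag N M D) = N * M" "dim_col (block_diag N M D) = N * M"
  by (auto simp: block_diag_def)

lemma block_diag_mult:
  assumes "\<And>x. x < N \<Longrightarrow> A x \<in> carrier_mat M M" "\<And>x. x < N \<Longrightarrow> B x \<in> carrier_mat M M"
  shows "block_diag N M A * block_diag N M B = block_diag N M (\<lambda>x. A x * B x)"
proof (intro eq_matI)
  fix i j assume "i < dim_row (block_diag N M (\<lambda>x. A x * B x))" "j < dim_col (block_diag N M (\<lambda>x. A x * B x))"
  then have i: "i < N * M" and j: "j < N * M" by auto
  have ik: "i div M < N" "i mod M < M" and jk: "j div M < N" "j mod M < M"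
    using i j by (auto simp: less_mult_imp_div_less mult_pos_imp_mod_less)
  have "(block_diag N M A * block_diag N M B) $$ (i, j) =
      (\<Sum>r<N * M. block_diag N M A $$ (i, r) * block_diag N M B $$ (r, j))"
    using i j by (intro index_mult_mat_sum) auto
  \<comment> \<open>Neither factor changes the selector state, so only the state of row
    \<open>i\<close> survives in the sum over \<open>x\<close>.\<close>
  also have "\<dots> = (\<Sum>x<N. if x = i div M then (if i div M = j div M then
      (\<Sum>y<M. A x $$ (i mod M, y) * B x $$ (y, j mod M)) else 0) else 0)"
    unfolding sum_lessThan_mult
    using i j by (intro sum.cong) (auto simp: block_diag_def mult_add_less intro!: sum.neutral)
  also have "\<dots> = (if i div M = j div M then
      (\<Sum>y<M. A (i div M) $$ (i mod M, y) * B (i div M) $$ (y, j mod M)) else 0)"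
    using ik by simp
  also have "\<dots> = block_diag N M (\<lambda>x. A x * B x) $$ (i, j)"
    using i j index_mult_mat_sum[OF assms(1)[OF ik(1)] assms(2)[OF ik(1)] ik(2) jk(2)]
    by (auto simp: block_diag_def simp del: index_mult_mat(1))
  finally show "(block_diag N M A * block_diag N M B) $$ (i, j) =
    block_diag N M (\<lambda>x. A x * B x) $$ (i, j)" .
qed auto

lemma block_diag_one: "block_diag N M (\<lambda>x. 1\<^sub>m M) = 1\<^sub>m (N * M)"
proof -
  have "(i div M = j div M \<and> i mod M = j mod M) = (i = j)" for i j
    by (metis div_mult_mod_eq)
  then show ?thesis
    by (intro eq_matI) (auto simp: block_diag_def mult_pos_imp_mod_less)
qed

lemma block_diag_cong:
  "(\<And>x. x < N \<Longrightarrow> A x = B x) \<Longrightarrow> block_diag N M A = block_diag N M B"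
  by (intro eq_matI) (auto simp: block_diag_def less_mult_imp_div_less)

lemma mat_adjoint_block_diag:
  assumes "\<And>x. x < N \<Longrightarrow> A x \<in> carrier_mat M M"
  shows "mat_adjoint (block_diag N M A) = block_diag N M (\<lambda>x. mat_adjoint (A x))"
proof (intro eq_matI)
  fix i j
  assume "i < dim_row (block_diag N M (\<lambda>x. mat_adjoint (A x)))"
    "j < dim_col (block_diag N M (\<lambda>x. mat_adjoint (A x)))"
  then have i: "i < N * M" and j: "j < N * M" by auto
  have "A (i div M) \<in> carrier_mat M M"
    using i assms by (simp add: less_mult_imp_div_less)
  then show "mat_adjoint (block_diag N M A) $$ (i, j) = block_diag N M (\<lambda>x. mat_adjoint (A x)) $$ (i, j)"
    using i j by (auto simp: block_diag_def mult_pos_imp_mod_less)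
qed auto

lemma unitary_mat_block_diag:
  assumes "\<And>x. x < N \<Longrightarrow> unitary_mat M (A x)"
  shows "unitary_mat (N * M) (block_diag N M A)"
proof -
  have c: "A x \<in> carrier_mat M M" if "x < N" for x
    using assms[OF that] by (rule unitary_matD)
  have eq: "block_diag N M (\<lambda>x. mat_adjoint (A x) * A x) = block_diag N M (\<lambda>x. 1\<^sub>m M)"
    "block_diag N M (\<lambda>x. A x * mat_adjoint (A x)) = block_diag N M (\<lambda>x. 1\<^sub>m M)"
    using assms by (intro block_diag_cong; auto simp: unitary_mat_def)+
  show ?thesis
    by (simp add: unitary_mat_def mat_adjoint_block_diag[OF c] block_diag_mult c eq block_diag_one)
qed

text \<open>Control on one selector state leaves the identity on all others, so a single block is
  nontrivial. This reduces products of controlled gates to blockwise products.\<close>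

lemma controlled_block_diag:
  assumes "V \<in> carrier_mat M M"
  shows "controlled a k \<phi> V = block_diag (2 ^ a) M (\<lambda>x. if x = k then cis \<phi> \<cdot>\<^sub>m V else 1\<^sub>m M)"
  using assms
  by (intro eq_matI)
     (auto simp: controlled_def block_diag_def index_kron basis_projector_def
       less_mult_imp_div_less mult_pos_imp_mod_less)

text \<open>Indices below \<open>M\<close> have the selector in state 0, so only column 0 of
  \<open>U\<close> enters. The left factor gives the conjugate amplitude at \<open>x\<close>, the
  middle factor preserves \<open>x\<close>, and the right factor gives the amplitude itself.\<close>

lemma kron_one_conj_block_diag:
  assumes U: "U \<in> carrier_mat N N" and D: "\<And>x. x < N \<Longrightarrow> D x \<in> carrier_mat M M"
    and N: "0 < N" and i: "i < M" and j: "j < M"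
  shows "(mat_adjoint (kron U (1\<^sub>m M)) * block_diag N M D * kron U (1\<^sub>m M)) $$ (i, j) =
    (\<Sum>x<N. cnj (U $$ (x, 0)) * U $$ (x, 0) * D x $$ (i, j))"
proof -
  have MN: "M \<le> N * M" using N by simp
  then have iN: "i < N * M" and jN: "j < N * M" using i j by (auto intro: less_le_trans)
  have K: "kron U (1\<^sub>m M) \<in> carrier_mat (N * M) (N * M)" using U by auto
  \<comment> \<open>For \<open>z < M\<close> the selector part \<open>z div M\<close> of the column
    index is 0.\<close>
  have k: "kron U (1\<^sub>m M) $$ (x * M + y, z) = (if y = z then U $$ (x, 0) else 0)"
    if "x < N" "y < M" "z < M" for x y z
    using that U iN MN by (subst index_kron) (auto simp: mult_add_less less_le_trans)
  have 1: "(mat_adjoint (kron U (1\<^sub>m M)) * block_diag N M D) $$ (i, x * M + y) =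
      cnj (U $$ (x, 0)) * D x $$ (i, y)" if x: "x < N" and y: "y < M" for x y
  proof -
    have "(mat_adjoint (kron U (1\<^sub>m M)) * block_diag N M D) $$ (i, x * M + y) =
      (\<Sum>r<N * M. mat_adjoint (kron U (1\<^sub>m M)) $$ (i, r) * block_diag N M D $$ (r, x * M + y))"
      using iN x y K by (intro index_mult_mat_sum) (auto simp: mult_add_less)
    also have "\<dots> = (\<Sum>x'<N. \<Sum>y'<M. if y' = i then (if x' = x then cnj (U $$ (x, 0)) * D x $$ (i, y) else 0) else 0)"
      unfolding sum_lessThan_mult
      using iN x y K U i by (intro sum.cong refl) (auto simp: k block_diag_def mult_add_less)
    also have "\<dots> = cnj (U $$ (x, 0)) * D x $$ (i, y)"
      using i x by simp
    finally show ?thesis .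
  qed
  have "(mat_adjoint (kron U (1\<^sub>m M)) * block_diag N M D * kron U (1\<^sub>m M)) $$ (i, j) =
    (\<Sum>r<N * M. (mat_adjoint (kron U (1\<^sub>m M)) * block_diag N M D) $$ (i, r) * kron U (1\<^sub>m M) $$ (r, j))"
    using iN jN K by (intro index_mult_mat_sum mult_carrier_mat[of _ _ "N * M"]) auto
  also have "\<dots> = (\<Sum>x<N. \<Sum>y<M. if y = j then cnj (U $$ (x, 0)) * U $$ (x, 0) * D x $$ (i, j) else 0)"
    unfolding sum_lessThan_mult
    using j by (intro sum.cong refl) (auto simp: k 1 simp del: index_mult_mat(1))
  also have "\<dots> = (\<Sum>x<N. cnj (U $$ (x, 0)) * U $$ (x, 0) * D x $$ (i, j))"
    using j by simp
  finally show ?thesis .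
qed

section \<open>Compression to the zero ancilla state\<close>

lemma ancilla_block_carrier [simp]: "ancilla_block n t W \<in> carrier_mat (2 ^ n) (2 ^ n)"
  by (intro carrier_matI) (auto simp: ancilla_block_def ket0_def)

text \<open>The ancillas hold the most significant bits, so they are all zero exactly at the indices
  below \<open>2 ^ n\<close>. Compression therefore reads off the top left corner.\<close>

lemma index_ancilla_block:
  assumes W: "W \<in> carrier_mat (2 ^ (t + n)) (2 ^ (t + n))" and i: "i < 2 ^ n" and j: "j < 2 ^ n"
  shows "ancilla_block n t W $$ (i, j) = W $$ (i, j)"
proof -
  let ?k = "kron (ket0 t) (1\<^sub>m (2 ^ n))"
  have K: "?k \<in> carrier_mat (2 ^ (t + n)) (2 ^ n)"
    by (auto simp: ket0_def power_add)
  \<comment> \<open>Tensoring with the zero ancilla state sends basis vector \<open>y\<close> to the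
    basis vector with the same index in the larger space.\<close>
  have k: "?k $$ (x, y) = (if x = y then 1 else 0)" if x: "x < 2 ^ (t + n)" and y: "y < 2 ^ n" for x y
  proof -
    have "x div 2 ^ n < 2 ^ t"
      using x by (simp add: less_mult_imp_div_less power_add)
    moreover have "(x div 2 ^ n = 0 \<and> x mod 2 ^ n = y) = (x = y)"
      using y by (auto simp: div_eq_0_iff)
    ultimately show ?thesis
      using x y by (auto simp: index_kron ket0_def power_add)
  qed
  have le: "(2 :: nat) ^ n \<le> 2 ^ (t + n)" by simp
  have adj: "kron (mat_adjoint (ket0 t)) (1\<^sub>m (2 ^ n)) = mat_adjoint ?k"
    by (simp add: mat_adjoint_kron)
  have 1: "(mat_adjoint ?k * W) $$ (i, r) = W $$ (i, r)" if r: "r < 2 ^ (t + n)" for r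
  proof -
    have "(mat_adjoint ?k * W) $$ (i, r) = (\<Sum>q<2 ^ (t + n). mat_adjoint ?k $$ (i, q) * W $$ (q, r))"
      using W r i K by (intro index_mult_mat_sum) auto
    also have "\<dots> = (\<Sum>q<2 ^ (t + n). if q = i then W $$ (i, r) else 0)"
    proof (intro sum.cong refl)
      fix q :: nat assume "q \<in> {..<2 ^ (t + n)}"
      then show "mat_adjoint ?k $$ (i, q) * W $$ (q, r) = (if q = i then W $$ (i, r) else 0)"
        using K i by (subst index_mat_adjoint) (auto simp: k)
    qed
    also have "\<dots> = W $$ (i, r)" using i le by (auto simp: less_le_trans)
    finally show ?thesis .
  qed
  have "ancilla_block n t W $$ (i, j) = (\<Sum>r<2 ^ (t + n). (mat_adjoint ?k * W) $$ (i, r) * ?k $$ (r, j))"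
    unfolding ancilla_block_def adj
    using W i j K by (intro index_mult_mat_sum mult_carrier_mat[of _ _ "2 ^ (t + n)"]) auto
  also have "\<dots> = (\<Sum>r<2 ^ (t + n). if r = j then W $$ (i, j) else 0)"
    using j by (intro sum.cong refl) (auto simp: 1 k simp del: index_mult_mat(1))
  also have "\<dots> = W $$ (i, j)" using j le by (auto simp: less_le_trans)
  finally show ?thesis .
qed

section \<open>Operator norm\<close>

lemma l2norm_zero [simp]: "l2norm (0\<^sub>v n) = 0"
  by (simp add: l2norm_def L2_set_0')

lemma l2norm_add:
  assumes "u \<in> carrier_vec n" "v \<in> carrier_vec n"
  shows "l2norm (u + v) \<le> l2norm u + l2norm v"
proof -
  have "l2norm (u + v) \<le> L2_set (\<lambda>i. cmod (u $ i) + cmod (v $ i)) {..<n}"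
    using assms unfolding l2norm_def by (auto intro!: L2_set_mono norm_triangle_ineq)
  also have "\<dots> \<le> l2norm u + l2norm v"
    using assms L2_set_triangle_ineq[of "\<lambda>i. cmod (u $ i)" "\<lambda>i. cmod (v $ i)" "{..<n}"]
    by (simp add: l2norm_def)
  finally show ?thesis .
qed

lemma l2norm_smult: "l2norm (c \<cdot>\<^sub>v v) = cmod c * l2norm v"
proof -
  have "L2_set (\<lambda>i. cmod ((c \<cdot>\<^sub>v v) $ i)) {..<dim_vec v} = L2_set (\<lambda>i. cmod c * cmod (v $ i)) {..<dim_vec v}"
    by (intro L2_set_cong) (auto simp: norm_mult)
  then show ?thesis
    by (simp add: l2norm_def L2_set_right_distrib)
qed

text \<open>A crude bound that makes the set in the definition of \<open>opnorm\<close> bounded, so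
  that its supremum is an upper bound. Each entry of \<open>v\<close> has modulus at most 1.\<close>

lemma l2norm_mult_mat_vec_le:
  assumes "v \<in> carrier_vec (dim_col A)" "l2norm v \<le> 1"
  shows "l2norm (A *\<^sub>v v) \<le> (\<Sum>i<dim_row A. \<Sum>j<dim_col A. cmod (A $$ (i, j)))"
proof -
  have v: "cmod (v $ j) \<le> 1" if "j < dim_col A" for j
  proof -
    have "cmod (v $ j) \<le> l2norm v"
      unfolding l2norm_def using that assms(1) by (intro member_le_L2_set) auto
    then show ?thesis using assms(2) by simp
  qed
  have "l2norm (A *\<^sub>v v) \<le> (\<Sum>i<dim_row A. cmod ((A *\<^sub>v v) $ i))"
    using L2_set_le_sum[of "{..<dim_row A}" "\<lambda>i. cmod ((A *\<^sub>v v) $ i)"] by (simp add: l2norm_def)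
  also have "\<dots> \<le> (\<Sum>i<dim_row A. \<Sum>j<dim_col A. cmod (A $$ (i, j)))"
  proof (rule sum_mono)
    fix i assume "i \<in> {..<dim_row A}"
    then have "(A *\<^sub>v v) $ i = (\<Sum>j<dim_col A. A $$ (i, j) * v $ j)"
      using assms(1) by (simp add: scalar_prod_def atLeast0LessThan)
    also have "cmod \<dots> \<le> (\<Sum>j<dim_col A. cmod (A $$ (i, j)))"
      using v by (intro order.trans[OF norm_sum] sum_mono) (auto simp: norm_mult mult_left_le)
    finally show "cmod ((A *\<^sub>v v) $ i) \<le> (\<Sum>j<dim_col A. cmod (A $$ (i, j)))" .
  qed
  finally show ?thesis .
qed

lemma l2norm_le_opnorm:
  assumes "v \<in> carrier_vec (dim_col A)" "l2norm v \<le> 1"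
  shows "l2norm (A *\<^sub>v v) \<le> opnorm A"
  unfolding opnorm_def
  using assms by (intro cSUP_upper bdd_aboveI2[where M = "\<Sum>i<dim_row A. \<Sum>j<dim_col A. cmod (A $$ (i, j))"])
    (auto intro: l2norm_mult_mat_vec_le)

lemma opnorm_leI:
  assumes "\<And>v. v \<in> carrier_vec (dim_col A) \<Longrightarrow> l2norm v \<le> 1 \<Longrightarrow> l2norm (A *\<^sub>v v) \<le> e"
  shows "opnorm A \<le> e"
  unfolding opnorm_def
proof (rule cSUP_least)
  have "0\<^sub>v (dim_col A) \<in> {v \<in> carrier_vec (dim_col A). l2norm v \<le> 1}" by simp
  then show "{v \<in> carrier_vec (dim_col A). l2norm v \<le> 1} \<noteq> {}" by blast
qed (use assms in auto)

lemma opnorm_add_smult: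
  assumes "A \<in> carrier_mat N M" "B \<in> carrier_mat N M"
  shows "opnorm (A + c \<cdot>\<^sub>m B) \<le> opnorm A + cmod c * opnorm B"
proof (rule opnorm_leI)
  fix v :: "complex vec" assume "v \<in> carrier_vec (dim_col (A + c \<cdot>\<^sub>m B))" and v1: "l2norm v \<le> 1"
  with assms have v: "v \<in> carrier_vec M" by auto
  have "(A + c \<cdot>\<^sub>m B) *\<^sub>v v = A *\<^sub>v v + (c \<cdot>\<^sub>m B) *\<^sub>v v"
    using assms v by (intro add_mult_distrib_mat_vec) auto
  also have "(c \<cdot>\<^sub>m B) *\<^sub>v v = c \<cdot>\<^sub>v (B *\<^sub>v v)"
    using assms v by (intro eq_vecI) (auto simp: smult_scalar_prod_distrib[of _ M])
  finally have "l2norm ((A + c \<cdot>\<^sub>m B) *\<^sub>v v) \<le> l2norm (A *\<^sub>v v) + l2norm (c \<cdot>\<^sub>v (B *\<^sub>v v))"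
    using assms v by (auto intro: l2norm_add[of _ N])
  also have "\<dots> \<le> opnorm A + cmod c * opnorm B"
    using assms v v1 by (auto simp: l2norm_smult intro!: add_mono mult_left_mono l2norm_le_opnorm)
  finally show "l2norm ((A + c \<cdot>\<^sub>m B) *\<^sub>v v) \<le> opnorm A + cmod c * opnorm B" .
qed

section \<open>Real linear combinations of operators\<close>

lemma lincomb_mat_carrier [simp]: "lincomb_mat N l \<Omega> L \<in> carrier_mat N N"
  by (simp add: lincomb_mat_def)

lemma lincomb_mat_0: "lincomb_mat N 0 \<Omega> L = 0\<^sub>m N N"
  by (intro eq_matI) (auto simp: lincomb_mat_def)

lemma lincomb_mat_Suc:
  assumes "L (Suc l) \<in> carrier_mat N N"
  shows "lincomb_mat N (Suc l) \<Omega> L = lincomb_mat N l \<Omega> L + complex_of_real (\<Omega> (Suc l)) \<cdot>\<^sub>m L (Suc l)"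
  using assms by (intro eq_matI) (auto simp: lincomb_mat_def)

text \<open>Triangle inequality, applied to one summand at a time.\<close>

lemma opnorm_lincomb_mat:
  assumes "\<And>s. s \<in> {1..l} \<Longrightarrow> B s \<in> carrier_mat N N"
  shows "opnorm (lincomb_mat N l \<Omega> B) \<le> (\<Sum>s = 1..l. \<bar>\<Omega> s\<bar> * opnorm (B s))"
  using assms
proof (induction l)
  case 0
  have "0\<^sub>m N N *\<^sub>v v = 0\<^sub>v N" if "v \<in> carrier_vec N" for v :: "complex vec"
    using that by (intro eq_vecI) auto
  then show ?case by (auto simp: lincomb_mat_0 intro!: opnorm_leI)
next
  case (Suc l)
  have "B (Suc l) \<in> carrier_mat N N" using Suc.prems by simp
  then show ?case
    using opnorm_add_smult[of "lincomb_mat N l \<Omega> B" N N "B (Suc l)" "complex_of_real (\<Omega> (Suc l))"] Suc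
    by (simp add: lincomb_mat_Suc)
qed

lemma lincomb_mat_sandwich:
  assumes "\<And>s. s \<in> {1..l} \<Longrightarrow> B s \<in> carrier_mat N N" and P: "P \<in> carrier_mat N N"
  shows "P * lincomb_mat N l \<Omega> B * P = lincomb_mat N l \<Omega> (\<lambda>s. P * B s * P)"
  using assms(1)
proof (induction l)
  case 0
  then show ?case using P by (simp add: lincomb_mat_0)
next
  case (Suc l)
  have B: "B (Suc l) \<in> carrier_mat N N" using Suc.prems by simp
  have "P * lincomb_mat N (Suc l) \<Omega> B * P =
      P * lincomb_mat N l \<Omega> B * P + complex_of_real (\<Omega> (Suc l)) \<cdot>\<^sub>m (P * B (Suc l) * P)"
    using B P by (simp add: lincomb_mat_Suc mult_add_distrib_mat[of _ N N _ N]
      mult_smult_distrib[of _ N N _ N] add_mult_distrib_mat[of _ N N _ _ N]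
      mult_smult_assoc_mat[of _ N N _ N] mult_carrier_mat[of _ N N _ N])
  also have "\<dots> = lincomb_mat N (Suc l) \<Omega> (\<lambda>s. P * B s * P)"
    using Suc B P by (subst lincomb_mat_Suc) (auto simp: mult_carrier_mat[of _ N N _ N])
  finally show ?case .
qed

section \<open>State preparation and selection\<close>

text \<open>Injectivity of \<open>sel\<close> allows reindexing by labels, and selector states
  without a label contribute nothing.\<close>

lemma sum_selector_labels:
  fixes f :: "nat \<Rightarrow> 'a :: comm_monoid_add"
  assumes "selector_labels a l sel" "\<And>x. x \<notin> sel ` {1..l} \<Longrightarrow> f x = 0"
  shows "(\<Sum>x<2 ^ a. f x) = (\<Sum>s = 1..l. f (sel s))"
proof -
  have "(\<Sum>x<2 ^ a. f x) = (\<Sum>x\<in>sel ` {1..l}. f x)"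
    using assms by (intro sum.mono_neutral_right) (auto simp: selector_labels_def)
  also have "\<dots> = (\<Sum>s = 1..l. f (sel s))"
    using assms(1) by (subst sum.reindex) (auto simp: selector_labels_def)
  finally show ?thesis .
qed

text \<open>
  The Householder reflection exchanging \<open>e\<^sub>0\<close> and \<open>v\<close>.  If \<open>v = e\<^sub>0\<close>, the
  convention \<open>x / 0 = 0\<close> turns it into the identity.
\<close>

lemma ex_unitary_mat_first_column:
  fixes v :: "nat \<Rightarrow> real"
  assumes N: "0 < N" and v: "(\<Sum>i<N. (v i)\<^sup>2) = 1"
  shows "\<exists>U. unitary_mat N U \<and> (\<forall>i<N. U $$ (i, 0) = complex_of_real (v i))"
proof -
  define w where "w i = of_bool (i = 0) - v i" for i :: nat
  define c where "c = 1 - v 0"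
  \<comment> \<open>The fact \<open>ww\<close> below gives \<open>w\<close> the squared length
    \<open>2 * c\<close>, so for nonzero \<open>c\<close> this is the reflection I - 2 w w^T / |w|^2
    along w = e_0 - v.\<close>
  define R where "R i j = of_bool (i = j) - w i * w j / c" for i j
  define U where "U = mat N N (\<lambda>(i, j). complex_of_real (R i j))"
  have U: "U \<in> carrier_mat N N" by (simp add: U_def)
  have "(w k)\<^sup>2 = (if k = 0 then 1 - 2 * v 0 else 0) + (v k)\<^sup>2" for k
    by (simp add: w_def power2_eq_square algebra_simps)
  then have ww: "(\<Sum>k<N. (w k)\<^sup>2) = 2 * c"
    using N v by (simp add: sum.distrib c_def)
  have RR: "(\<Sum>k<N. R i k * R k j) = of_bool (i = j)" if "i < N" "j < N" for i j
  proof -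
    \<comment> \<open>Expanding the square gives I - 2 w w^T / c + |w|^2 w w^T / c^2, and the last
      two terms cancel by |w|^2 = 2 c.\<close>
    have "(\<Sum>k<N. R i k * R k j) = (\<Sum>k<N. (if k = i then of_bool (i = j) - w i * w j / c else 0)
        + (if k = j then - (w i * w j / c) else 0) + (w i * w j / c\<^sup>2) * (w k)\<^sup>2)"
      by (intro sum.cong refl) (auto simp: R_def power2_eq_square algebra_simps)
    also have "\<dots> = of_bool (i = j) - 2 * (w i * w j / c) + (w i * w j / c\<^sup>2) * (2 * c)"
      using that by (simp only: sum.distrib sum_distrib_left[symmetric] ww) simp
    also have "\<dots> = of_bool (i = j)"
      by (cases "c = 0") (auto simp: power2_eq_square)
    finally show ?thesis .
  qed
  have adj: "mat_adjoint U = U"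
    by (intro eq_matI) (auto simp: U_def R_def mult.commute eq_commute)
  have "U * U = 1\<^sub>m N"
  proof (intro eq_matI)
    fix i j assume "i < dim_row (1\<^sub>m N :: complex mat)" "j < dim_col (1\<^sub>m N :: complex mat)"
    then have ij: "i < N" "j < N" by auto
    have "(U * U) $$ (i, j) = complex_of_real (\<Sum>k<N. R i k * R k j)"
      using ij by (subst index_mult_mat_sum[OF U U]) (auto simp: U_def)
    then show "(U * U) $$ (i, j) = (1\<^sub>m N :: complex mat) $$ (i, j)"
      using ij by (simp add: RR del: index_mult_mat(1))
  qed (auto simp: U_def)
  then have "unitary_mat N U" using U by (simp add: unitary_mat_def adj)
  moreover have "R i 0 = v i" if "i < N" for i
  proof (cases "c = 0")
    case True
    \<comment> \<open>In the degenerate case \<open>w\<close> has length 0, so \<open>v\<close>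
      already is the first basis vector.\<close>
    then have "(\<Sum>k<N. (w k)\<^sup>2) = 0" using ww by simp
    then have "w i = 0" using that by (simp add: sum_nonneg_eq_0_iff)
    then show ?thesis by (simp add: R_def w_def)
  next
    case False
    \<comment> \<open>Since \<open>w 0 = c\<close>, column 0 is e_0 - w = v.\<close>
    then show ?thesis by (simp add: R_def w_def c_def)
  qed
  ultimately show ?thesis using N by (auto simp: U_def)
qed

lemma mult_mat_vec_unit_vec:
  assumes "U \<in> carrier_mat N M" "j < M" "i < N"
  shows "(U *\<^sub>v unit_vec M j) $ i = (U $$ (i, j) :: complex)"
  using assms by (simp add: scalar_prod_right_unit[of _ M])

text \<open>The prescribed amplitudes are real, and their squares sum to 1 by the choice of
  \<open>\<alpha>\<close>, so a Householder reflection has them as its first column.\<close>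

lemma ex_prep_unitary:
  assumes sel: "selector_labels a l sel" and \<alpha>s: "\<And>s. s \<in> {1..l} \<Longrightarrow> 0 \<le> \<alpha>s s"
    and \<alpha>: "\<alpha> = (\<Sum>s = 1..l. \<bar>\<Omega> s\<bar> * \<alpha>s s)" "0 < \<alpha>"
  shows "\<exists>U. prep_unitary a l sel \<Omega> \<alpha>s \<alpha> U"
proof -
  define v where "v i = (1 / sqrt \<alpha>) * (\<Sum>s = 1..l. sqrt (\<bar>\<Omega> s\<bar> * \<alpha>s s) * (if i = sel s then 1 else 0))"
    for i
  have inj: "inj_on sel {1..l}" using sel by (simp add: selector_labels_def)
  have vs: "v (sel s) = sqrt (\<bar>\<Omega> s\<bar> * \<alpha>s s) / sqrt \<alpha>" if "s \<in> {1..l}" for s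
  proof -
    have "(\<Sum>s' = 1..l. sqrt (\<bar>\<Omega> s'\<bar> * \<alpha>s s') * (if sel s = sel s' then 1 else 0)) =
        (\<Sum>s' = 1..l. if s = s' then sqrt (\<bar>\<Omega> s'\<bar> * \<alpha>s s') else 0)"
      using that by (intro sum.cong) (simp_all add: inj_on_eq_iff[OF inj])
    then show ?thesis using that by (simp add: v_def)
  qed
  have "(\<Sum>x<2 ^ a. (v x)\<^sup>2) = (\<Sum>s = 1..l. (v (sel s))\<^sup>2)"
    using sel by (rule sum_selector_labels) (auto simp: v_def intro!: sum.neutral)
  also have "\<dots> = (\<Sum>s = 1..l. \<bar>\<Omega> s\<bar> * \<alpha>s s / \<alpha>)"
    using \<alpha>s \<alpha>(2) by (intro sum.cong) (auto simp: vs power_divide)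
  also have "\<dots> = 1"
    using \<alpha> by (simp flip: sum_divide_distrib)
  finally obtain U where U: "unitary_mat (2 ^ a) U" "\<forall>i<2 ^ a. U $$ (i, 0) = complex_of_real (v i)"
    using ex_unitary_mat_first_column[of "2 ^ a" v] by auto
  have c: "U \<in> carrier_mat (2 ^ a) (2 ^ a)" using U(1) by (rule unitary_matD)
  have "prep_unitary a l sel \<Omega> \<alpha>s \<alpha> U"
    unfolding prep_unitary_def
  proof (intro conjI U(1) eq_vecI)
    fix i assume "i < dim_vec (complex_of_real (1 / sqrt \<alpha>) \<cdot>\<^sub>v vec (2 ^ a) (\<lambda>i. \<Sum>s = 1..l.
        complex_of_real (sqrt (\<bar>\<Omega> s\<bar> * \<alpha>s s)) * (if i = sel s then 1 else 0)))"
    then have i: "i < 2 ^ a" by simp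
    have "complex_of_real (v i) = complex_of_real (1 / sqrt \<alpha>) * (\<Sum>s = 1..l.
        complex_of_real (sqrt (\<bar>\<Omega> s\<bar> * \<alpha>s s)) * (if i = sel s then 1 else 0))"
      unfolding v_def of_real_mult of_real_sum by (intro arg_cong2[of _ _ _ _ "(*)"] refl sum.cong) auto
    then show "(U *\<^sub>v unit_vec (2 ^ a) 0) $ i = (complex_of_real (1 / sqrt \<alpha>) \<cdot>\<^sub>v vec (2 ^ a) (\<lambda>i. \<Sum>s = 1..l.
        complex_of_real (sqrt (\<bar>\<Omega> s\<bar> * \<alpha>s s)) * (if i = sel s then 1 else 0))) $ i"
      using i U(2) by (simp add: mult_mat_vec_unit_vec[OF c] del: index_mult_mat_vec)
  qed (use c in auto)
  then show ?thesis by blast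
qed

text \<open>Column 0 is the image of basis state 0, and by injectivity of \<open>sel\<close> at most
  one label contributes to its entry at \<open>x\<close>.\<close>

lemma prep_unitary_first_column:
  assumes prep: "prep_unitary a l sel \<Omega> \<alpha>s \<alpha> U" and sel: "selector_labels a l sel" and x: "x < 2 ^ a"
  shows "x \<notin> sel ` {1..l} \<Longrightarrow> U $$ (x, 0) = 0"
    and "s \<in> {1..l} \<Longrightarrow> x = sel s \<Longrightarrow> U $$ (x, 0) = complex_of_real (sqrt (\<bar>\<Omega> s\<bar> * \<alpha>s s) / sqrt \<alpha>)"
proof -
  have c: "U \<in> carrier_mat (2 ^ a) (2 ^ a)"
    using prep by (auto simp: prep_unitary_def unitary_mat_def)
  have "U $$ (x, 0) = (U *\<^sub>v unit_vec (2 ^ a) 0) $ x"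
    using x by (simp add: mult_mat_vec_unit_vec[OF c] del: index_mult_mat_vec)
  also have "\<dots> = complex_of_real (1 / sqrt \<alpha>) * (\<Sum>s = 1..l.
      complex_of_real (sqrt (\<bar>\<Omega> s\<bar> * \<alpha>s s)) * (if x = sel s then 1 else 0))"
    using prep x by (simp add: prep_unitary_def del: index_mult_mat_vec)
  finally have *: "U $$ (x, 0) = complex_of_real (1 / sqrt \<alpha>) * (\<Sum>s = 1..l.
      complex_of_real (sqrt (\<bar>\<Omega> s\<bar> * \<alpha>s s)) * (if x = sel s then 1 else 0))" .
  show "U $$ (x, 0) = 0" if "x \<notin> sel ` {1..l}"
    unfolding * using that by (auto intro!: sum.neutral)
  have inj: "inj_on sel {1..l}" using sel by (simp add: selector_labels_def)
  show "U $$ (x, 0) = complex_of_real (sqrt (\<bar>\<Omega> s\<bar> * \<alpha>s s) / sqrt \<alpha>)" if s: "s \<in> {1..l}" "x = sel s"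
  proof -
    have "(\<Sum>s' = 1..l. complex_of_real (sqrt (\<bar>\<Omega> s'\<bar> * \<alpha>s s')) * (if x = sel s' then 1 else 0)) =
        (\<Sum>s' = 1..l. if s = s' then complex_of_real (sqrt (\<bar>\<Omega> s'\<bar> * \<alpha>s s')) else 0)"
      using s by (intro sum.cong) (simp_all add: inj_on_eq_iff[OF inj])
    then show ?thesis using s(1) by (simp add: *)
  qed
qed

text \<open>The block at selector state \<open>x\<close> of the product of the first
  \<open>k\<close> controlled gates. States that carry no label keep the identity, as they do under
  every controlled gate.\<close>

primrec select_block :: "nat \<Rightarrow> (nat \<Rightarrow> nat) \<Rightarrow> (nat \<Rightarrow> complex mat) \<Rightarrow> nat \<Rightarrow> nat \<Rightarrow> complex mat" where
  "select_block M sel V 0 x = 1\<^sub>m M"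
| "select_block M sel V (Suc k) x = (if x = sel (Suc k) then V (Suc k) else select_block M sel V k x)"

lemma select_block_off: "x \<notin> sel ` {1..k} \<Longrightarrow> select_block M sel V k x = 1\<^sub>m M"
  by (induction k) (auto simp: atLeastAtMostSuc_conv)

lemma select_block_label:
  "inj_on sel {1..k} \<Longrightarrow> s \<in> {1..k} \<Longrightarrow> select_block M sel V k (sel s) = V s"
proof (induction k)
  case (Suc k)
  show ?case
  proof (cases "s = Suc k")
    case False
    then have "sel s \<noteq> sel (Suc k)"
      using inj_onD[OF Suc.prems(1), of s "Suc k"] Suc.prems(2) by auto
    moreover have "inj_on sel {1..k}"
      using Suc.prems(1) by (rule inj_on_subset) auto
    ultimately show ?thesis
      using Suc.IH Suc.prems(2) False by simp
  qed simp
qed simp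

lemma select_block_unitary:
  "(\<And>s. s \<in> {1..k} \<Longrightarrow> unitary_mat M (V s)) \<Longrightarrow> unitary_mat M (select_block M sel V k x)"
  by (induction k) (auto simp: unitary_mat_one)

text \<open>A further controlled gate changes only the block at its own label, where the product so
  far is the identity.\<close>

lemma controlled_mult_select:
  assumes inj: "inj_on sel {1..Suc k}" and W: "\<And>s. s \<in> {1..Suc k} \<Longrightarrow> unitary_mat M (W s)"
  shows "controlled a (sel (Suc k)) (\<phi> (Suc k)) (W (Suc k)) *
      block_diag (2 ^ a) M (select_block M sel (\<lambda>s. cis (\<phi> s) \<cdot>\<^sub>m W s) k) =
    block_diag (2 ^ a) M (select_block M sel (\<lambda>s. cis (\<phi> s) \<cdot>\<^sub>m W s) (Suc k))"
proof -
  let ?V = "\<lambda>s. cis (\<phi> s) \<cdot>\<^sub>m W s"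
  have Wc: "W (Suc k) \<in> carrier_mat M M" using W[of "Suc k"] by (simp add: unitary_mat_def)
  have Sc: "select_block M sel ?V k x \<in> carrier_mat M M" for x
    using W by (intro unitary_matD(1) select_block_unitary unitary_mat_cis_smult) auto
  \<comment> \<open>Distinct labels ensure that no earlier gate has acted on this block.\<close>
  have "sel (Suc k) \<notin> sel ` {1..k}"
  proof
    assume "sel (Suc k) \<in> sel ` {1..k}"
    then obtain s where "s \<in> {1..k}" "sel (Suc k) = sel s" by auto
    with inj_onD[OF inj, of "Suc k" s] show False by auto
  qed
  then have "select_block M sel ?V k (sel (Suc k)) = 1\<^sub>m M" by (rule select_block_off)
  then show ?thesis
    using Wc Sc by (auto simp: controlled_block_diag block_diag_mult left_mult_one_mat[OF Sc]
      intro!: block_diag_cong)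
qed

section \<open>Circuits\<close>

lemma qubit_lift: "q < a \<Longrightarrow> qubit (a + b) i q = qubit a (i div 2 ^ b) q"
  by (simp add: qubit_def bit_drop_bit_eq add.commute flip: drop_bit_eq_div)

lemma mod_power_eq_iff_bits: "i mod 2 ^ b = j mod 2 ^ b \<longleftrightarrow> (\<forall>k<b. bit i k = bit j k)" for i j :: nat
  by (auto simp: bit_eq_iff bit_take_bit_iff simp flip: take_bit_eq_mod)

text \<open>The \<open>b\<close> appended qubits are the low-order bits and lie outside
  \<open>qs\<close>. Agreement off \<open>qs\<close> thus splits into a condition on the first
  \<open>a\<close> qubits and equality of the low-order parts.\<close>

lemma all_qubits_lift:
  assumes "set qs \<subseteq> {..<a}"
  shows "(\<forall>q<a + b. q \<notin> set qs \<longrightarrow> qubit (a + b) i q = qubit (a + b) j q) \<longleftrightarrow>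
    (\<forall>q<a. q \<notin> set qs \<longrightarrow> qubit a (i div 2 ^ b) q = qubit a (j div 2 ^ b) q) \<and>
    i mod 2 ^ b = j mod 2 ^ b" (is "?l \<longleftrightarrow> ?r1 \<and> ?r2")
proof (intro iffI conjI)
  assume l: ?l
  show ?r1 using l by (auto simp flip: qubit_lift)
  show ?r2 unfolding mod_power_eq_iff_bits
  proof (intro allI impI)
    fix k assume "k < b"
    \<comment> \<open>Bit \<open>k\<close> belongs to qubit \<open>a + b - 1 - k\<close>, which is
      at least \<open>a\<close> and hence outside \<open>qs\<close>.\<close>
    then have "a + b - 1 - k < a + b" "a + b - 1 - k \<notin> set qs" "a + b - 1 - (a + b - 1 - k) = k"
      using assms by auto
    then show "bit i k = bit j k" using l by (metis qubit_def)
  qed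
next
  assume r: "?r1 \<and> ?r2"
  show ?l
  proof (intro allI impI)
    fix q assume q: "q < a + b" "q \<notin> set qs"
    show "qubit (a + b) i q = qubit (a + b) j q"
    proof (cases "q < a")
      case True
      then show ?thesis using r q by (simp add: qubit_lift)
    next
      case False
      then have "a + b - 1 - q < b" using q by simp
      then show ?thesis using r by (simp add: mod_power_eq_iff_bits qubit_def)
    qed
  qed
qed

lemma subindex_lift:
  assumes "set qs \<subseteq> {..<a}"
  shows "subindex (a + b) qs i = subindex a qs (i div 2 ^ b)"
proof -
  have "qs ! k < a" if "k < length qs" for k
    using assms nth_mem[OF that] by auto
  then show ?thesis
    unfolding subindex_def by (intro sum.cong) (auto simp: qubit_lift)
qed

text \<open>Keeps the lookup of gate entries inside the gate matrix, as is required for taking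
  adjoints entrywise.\<close>

lemma subindex_less: "subindex m qs i < 2 ^ length qs"
proof -
  have "subindex m qs i \<le> (\<Sum>k<length qs. 2 ^ (length qs - Suc k))"
    unfolding subindex_def by (intro sum_mono) auto
  also have "\<dots> = (\<Sum>k<length qs. 2 ^ k)"
    by (rule sum.nat_diff_reindex)
  also have "\<dots> < 2 ^ length qs"
    by (simp add: lessThan_def flip: mask_eq_sum_exp_nat)
  finally show ?thesis .
qed

lemma placed_gate_mat_carrier [simp]: "placed_gate_mat m p \<in> carrier_mat (2 ^ m) (2 ^ m)"
  by (cases p) (simp add: placed_gate_mat_def)

lemma layer_mat_carrier [simp]: "layer_mat m ly \<in> carrier_mat (2 ^ m) (2 ^ m)"
  by (induction ly) (auto intro: mult_carrier_mat[OF _ placed_gate_mat_carrier])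

lemma circuit_mat_carrier [simp]: "circuit_mat m C \<in> carrier_mat (2 ^ m) (2 ^ m)"
  by (induction C) (auto intro: mult_carrier_mat[OF _ layer_mat_carrier])

text \<open>Equality of the low-order parts is the identity factor, and the gate sees only the
  high-order bits.\<close>

lemma placed_gate_mat_lift:
  assumes "set qs \<subseteq> {..<a}"
  shows "placed_gate_mat (a + b) (g, qs) = kron (placed_gate_mat a (g, qs)) (1\<^sub>m (2 ^ b))"
  by (intro eq_matI)
     (auto simp: placed_gate_mat_def index_kron power_add all_qubits_lift[OF assms] subindex_lift[OF assms]
       less_mult_imp_div_less mult_pos_imp_mod_less)

lemma layer_mat_lift:
  "(\<And>g qs. (g, qs) \<in> set ly \<Longrightarrow> set qs \<subseteq> {..<a}) \<Longrightarrow>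
    layer_mat (a + b) ly = kron (layer_mat a ly) (1\<^sub>m (2 ^ b))"
proof (induction ly)
  case (Cons p ly)
  obtain g qs where p: "p = (g, qs)" by (cases p)
  then have "placed_gate_mat (a + b) p = kron (placed_gate_mat a p) (1\<^sub>m (2 ^ b))"
    using Cons.prems[of g qs] by (simp add: placed_gate_mat_lift)
  moreover have "layer_mat (a + b) ly = kron (layer_mat a ly) (1\<^sub>m (2 ^ b))"
    by (rule Cons.IH) (use Cons.prems in auto)
  ultimately show ?case
    by (simp add: kron_mult[OF layer_mat_carrier placed_gate_mat_carrier one_carrier_mat one_carrier_mat])
qed (simp add: kron_one power_add)

lemma circuit_mat_lift:
  "(\<And>ly. ly \<in> set C \<Longrightarrow> layer_over G a ly) \<Longrightarrow>
    circuit_mat (a + b) C = kron (circuit_mat a C) (1\<^sub>m (2 ^ b))"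
proof (induction C)
  case (Cons ly C)
  have "layer_mat (a + b) ly = kron (layer_mat a ly) (1\<^sub>m (2 ^ b))"
    by (rule layer_mat_lift) (use Cons.prems[of ly] in \<open>auto simp: layer_over_def\<close>)
  moreover have "circuit_mat (a + b) C = kron (circuit_mat a C) (1\<^sub>m (2 ^ b))"
    by (rule Cons.IH) (use Cons.prems in auto)
  ultimately show ?case
    by (simp add: kron_mult[OF circuit_mat_carrier layer_mat_carrier one_carrier_mat one_carrier_mat])
qed (simp add: kron_one power_add)

text \<open>The same layers with the same qubit numbers serve the larger register, so the
  preparation keeps its depth when ancillas and system are added.\<close>

lemma implements_lift:
  assumes "implements G a C U"
  shows "implements G (a + b) C (kron U (1\<^sub>m (2 ^ b)))"
proof -
  have "layer_over G (a + b) ly" if "layer_over G a ly" for ly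
    using that by (fastforce simp: layer_over_def)
  then show ?thesis
    using assms circuit_mat_lift[of C G a b] by (auto simp: implements_def)
qed

section \<open>Concatenated and inverse circuits\<close>

lemma circuit_mat_append: "circuit_mat m (C @ D) = circuit_mat m D * circuit_mat m C"
  by (induction C)
     (auto simp: right_mult_one_mat[OF circuit_mat_carrier]
       assoc_mult_mat[OF circuit_mat_carrier circuit_mat_carrier layer_mat_carrier])

lemma implements_append:
  "implements G m C U \<Longrightarrow> implements G m D V \<Longrightarrow> implements G m (C @ D) (V * U)"
  by (auto simp: implements_def circuit_mat_append)

text \<open>The gates are also reversed because taking the adjoint of a product reverses its
  factors.\<close>

definition adjoint_layer :: "layer \<Rightarrow> layer" where
  "adjoint_layer ly = rev (map (\<lambda>(g, qs). (mat_adjoint g, qs)) ly)"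

definition adjoint_circuit :: "circuit \<Rightarrow> circuit" where
  "adjoint_circuit C = rev (map adjoint_layer C)"

lemma placed_gate_mat_adjoint:
  assumes "g \<in> carrier_mat (2 ^ length qs) (2 ^ length qs)"
  shows "placed_gate_mat m (mat_adjoint g, qs) = mat_adjoint (placed_gate_mat m (g, qs))"
  using assms by (intro eq_matI) (auto simp: placed_gate_mat_def subindex_less)

lemma layer_mat_append: "layer_mat m (xs @ ys) = layer_mat m ys * layer_mat m xs"
  by (induction xs)
     (auto simp: right_mult_one_mat[OF layer_mat_carrier]
       assoc_mult_mat[OF layer_mat_carrier layer_mat_carrier placed_gate_mat_carrier])

lemma layer_mat_adjoint:
  "(\<And>g qs. (g, qs) \<in> set ly \<Longrightarrow> g \<in> carrier_mat (2 ^ length qs) (2 ^ length qs)) \<Longrightarrow>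
    layer_mat m (adjoint_layer ly) = mat_adjoint (layer_mat m ly)"
proof (induction ly)
  case (Cons p ly)
  obtain g qs where p: "p = (g, qs)" by (cases p)
  then have "placed_gate_mat m (mat_adjoint g, qs) = mat_adjoint (placed_gate_mat m p)"
    using Cons.prems[of g qs] by (simp add: placed_gate_mat_adjoint)
  moreover have "layer_mat m (adjoint_layer ly) = mat_adjoint (layer_mat m ly)"
    by (rule Cons.IH) (use Cons.prems in auto)
  ultimately show ?case
    by (simp add: p adjoint_layer_def layer_mat_append left_mult_one_mat[OF placed_gate_mat_carrier]
      left_mult_one_mat[OF mat_adjoint_carrier[OF placed_gate_mat_carrier]]
      mat_adjoint_mult[OF layer_mat_carrier placed_gate_mat_carrier])
qed (simp add: adjoint_layer_def)

lemma circuit_mat_adjoint: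
  "(\<And>ly. ly \<in> set C \<Longrightarrow> layer_over G m ly) \<Longrightarrow>
    circuit_mat m (adjoint_circuit C) = mat_adjoint (circuit_mat m C)"
proof (induction C)
  case (Cons ly C)
  have "layer_mat m (adjoint_layer ly) = mat_adjoint (layer_mat m ly)"
    by (rule layer_mat_adjoint) (use Cons.prems[of ly] in \<open>auto simp: layer_over_def\<close>)
  moreover have "circuit_mat m (adjoint_circuit C) = mat_adjoint (circuit_mat m C)"
    by (rule Cons.IH) (use Cons.prems in auto)
  ultimately show ?case
    by (simp add: adjoint_circuit_def circuit_mat_append
      left_mult_one_mat[OF mat_adjoint_carrier[OF layer_mat_carrier]]
      mat_adjoint_mult[OF circuit_mat_carrier layer_mat_carrier])
qed (simp add: adjoint_circuit_def)

lemma layer_over_adjoint: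
  assumes "gate_set G" "layer_over G m ly"
  shows "layer_over G m (adjoint_layer ly)"
proof -
  have "map snd (adjoint_layer ly) = rev (map snd ly)"
    by (simp add: adjoint_layer_def rev_map case_prod_unfold)
  then have "distinct (concat (map snd (adjoint_layer ly)))"
    using assms(2) by (simp add: layer_over_def distinct_concat_rev)
  then show ?thesis
    using assms by (fastforce simp: layer_over_def gate_set_def adjoint_layer_def)
qed

text \<open>Provides the inverse preparation over the same gate set. Reversing the list of layers
  preserves its length, hence the depth.\<close>

lemma implements_adjoint:
  assumes "gate_set G" "implements G m C U"
  shows "implements G m (adjoint_circuit C) (mat_adjoint U)"
  using assms circuit_mat_adjoint[of C G m] layer_over_adjoint[OF assms(1)]
  by (auto simp: implements_def adjoint_circuit_def)

text \<open>Later layers are left factors, so appending the next controlled circuit multiplies from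
  the left and fills in one more block.\<close>

lemma implements_select:
  assumes "inj_on sel {1..k}" "\<And>s. s \<in> {1..k} \<Longrightarrow> unitary_mat (2 ^ b) (W s)"
    and "\<And>s. s \<in> {1..k} \<Longrightarrow> implements G (a + b) (Cs s) (controlled a (sel s) (\<phi> s) (W s))"
  shows "implements G (a + b) (concat (map Cs [1..<Suc k]))
    (block_diag (2 ^ a) (2 ^ b) (select_block (2 ^ b) sel (\<lambda>s. cis (\<phi> s) \<cdot>\<^sub>m W s) k))"
  using assms
proof (induction k)
  case 0
  then show ?case
    by (simp add: implements_def block_diag_one power_add)
next
  case (Suc k)
  have "implements G (a + b) (concat (map Cs [1..<Suc k]))
    (block_diag (2 ^ a) (2 ^ b) (select_block (2 ^ b) sel (\<lambda>s. cis (\<phi> s) \<cdot>\<^sub>m W s) k))"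
    by (rule Suc.IH) (use Suc.prems in \<open>auto intro: inj_on_subset\<close>)
  then have "implements G (a + b) (concat (map Cs [1..<Suc k]) @ Cs (Suc k))
    (controlled a (sel (Suc k)) (\<phi> (Suc k)) (W (Suc k)) *
      block_diag (2 ^ a) (2 ^ b) (select_block (2 ^ b) sel (\<lambda>s. cis (\<phi> s) \<cdot>\<^sub>m W s) k))"
    by (rule implements_append) (use Suc.prems in auto)
  moreover have "concat (map Cs [1..<Suc (Suc k)]) = concat (map Cs [1..<Suc k]) @ Cs (Suc k)"
    by simp
  ultimately show ?case
    using Suc.prems by (simp only: controlled_mult_select)
qed

section \<open>The linear combination of unitaries\<close>

text \<open>Here \<open>b\<close> counts all qubits outside the selector. It is used as
  \<open>t + n\<close>, so that all branches share the same \<open>t\<close> ancillas.\<close>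

definition lcu_mat ::
  "nat \<Rightarrow> nat \<Rightarrow> nat \<Rightarrow> (nat \<Rightarrow> nat) \<Rightarrow> (nat \<Rightarrow> real) \<Rightarrow> (nat \<Rightarrow> complex mat) \<Rightarrow> complex mat \<Rightarrow> complex mat" where
  "lcu_mat a b l sel \<phi> W U =
     mat_adjoint (kron U (1\<^sub>m (2 ^ b))) *
     block_diag (2 ^ a) (2 ^ b) (select_block (2 ^ b) sel (\<lambda>s. cis (\<phi> s) \<cdot>\<^sub>m W s) l) *
     kron U (1\<^sub>m (2 ^ b))"

lemma unitary_lcu_mat:
  assumes "unitary_mat (2 ^ a) U" "\<And>s. s \<in> {1..l} \<Longrightarrow> unitary_mat (2 ^ b) (W s)"
  shows "unitary_mat (2 ^ (a + b)) (lcu_mat a b l sel \<phi> W U)"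
  unfolding lcu_mat_def power_add using assms
  by (intro unitary_mat_mult unitary_mat_adjoint unitary_mat_kron unitary_mat_one
    unitary_mat_block_diag select_block_unitary unitary_mat_cis_smult)

text \<open>In the corner where the selector is in state 0, each branch is weighted by its squared
  amplitude, and its phase restores the sign of \<open>\<Omega> s\<close>.\<close>

lemma index_lcu_mat:
  assumes sel: "selector_labels a l sel" and prep: "prep_unitary a l sel \<Omega> \<alpha>s \<alpha> U"
    and W: "\<And>s. s \<in> {1..l} \<Longrightarrow> unitary_mat (2 ^ b) (W s)"
    and \<phi>: "\<And>s. s \<in> {1..l} \<Longrightarrow> complex_of_real (\<Omega> s) = complex_of_real \<bar>\<Omega> s\<bar> * cis (\<phi> s)"
    and \<alpha>s: "\<And>s. s \<in> {1..l} \<Longrightarrow> 0 \<le> \<alpha>s s" and \<alpha>: "0 < \<alpha>"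
    and i: "i < 2 ^ b" and j: "j < 2 ^ b"
  shows "lcu_mat a b l sel \<phi> W U $$ (i, j) =
    (\<Sum>s = 1..l. complex_of_real (\<Omega> s * \<alpha>s s / \<alpha>) * W s $$ (i, j))"
proof -
  let ?V = "\<lambda>s. cis (\<phi> s) \<cdot>\<^sub>m W s"
  let ?S = "select_block (2 ^ b) sel ?V l"
  \<comment> \<open>\<open>sum_selector_labels\<close> asks for vanishing at every natural number
    off the labels. The explicit case distinction provides this also beyond \<open>2 ^ a\<close>,
    where the entries of \<open>U\<close> are unspecified.\<close>
  let ?f = "\<lambda>x. if x \<in> sel ` {1..l} then cnj (U $$ (x, 0)) * U $$ (x, 0) * ?S x $$ (i, j) else 0"
  have U: "U \<in> carrier_mat (2 ^ a) (2 ^ a)"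
    using prep by (auto simp: prep_unitary_def unitary_mat_def)
  have S: "?S x \<in> carrier_mat (2 ^ b) (2 ^ b)" for x
    using W by (intro unitary_matD(1) select_block_unitary unitary_mat_cis_smult)
  have "lcu_mat a b l sel \<phi> W U $$ (i, j) =
      (\<Sum>x<2 ^ a. cnj (U $$ (x, 0)) * U $$ (x, 0) * ?S x $$ (i, j))"
    unfolding lcu_mat_def using U S i j by (intro kron_one_conj_block_diag) auto
  also have "\<dots> = (\<Sum>x<2 ^ a. ?f x)"
    by (intro sum.cong refl) (auto simp: prep_unitary_first_column(1)[OF prep sel])
  also have "\<dots> = (\<Sum>s = 1..l. ?f (sel s))"
    using sel by (rule sum_selector_labels) simp
  also have "\<dots> = (\<Sum>s = 1..l. complex_of_real (\<Omega> s * \<alpha>s s / \<alpha>) * W s $$ (i, j))"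
  proof (intro sum.cong refl)
    fix s assume s: "s \<in> {1..l}"
    have lt: "sel s < 2 ^ a" and inj: "inj_on sel {1..l}"
      using sel s by (auto simp: selector_labels_def)
    let ?r = "sqrt (\<bar>\<Omega> s\<bar> * \<alpha>s s) / sqrt \<alpha>"
    have Ws: "W s \<in> carrier_mat (2 ^ b) (2 ^ b)" using W[OF s] by (rule unitary_matD)
    have "?f (sel s) = cnj (complex_of_real ?r) * complex_of_real ?r * (cis (\<phi> s) * W s $$ (i, j))"
      using s i j Ws by (simp only: prep_unitary_first_column(2)[OF prep sel lt s refl]
        select_block_label[OF inj s]) simp
    also have "cnj (complex_of_real ?r) * complex_of_real ?r = complex_of_real (?r * ?r)"
      by (simp only: complex_cnj_complex_of_real of_real_mult)
    also have "?r * ?r = \<bar>\<Omega> s\<bar> * \<alpha>s s / \<alpha>"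
      using \<alpha>s[OF s] \<alpha> by simp
    \<comment> \<open>The factors are regrouped to bring the phase next to the modulus of
      \<open>\<Omega> s\<close>.\<close>
    also have "complex_of_real (\<bar>\<Omega> s\<bar> * \<alpha>s s / \<alpha>) * (cis (\<phi> s) * W s $$ (i, j)) =
        (complex_of_real \<bar>\<Omega> s\<bar> * cis (\<phi> s)) * complex_of_real (\<alpha>s s / \<alpha>) * W s $$ (i, j)"
      by simp
    also have "\<dots> = complex_of_real (\<Omega> s * \<alpha>s s / \<alpha>) * W s $$ (i, j)"
      by (simp flip: \<phi>[OF s])
    finally show "?f (sel s) = complex_of_real (\<Omega> s * \<alpha>s s / \<alpha>) * W s $$ (i, j)" .
  qed
  finally show ?thesis .
qed

text \<open>The error operator is the combination of the branch errors \<open>?B s\<close> with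
  coefficients \<open>?c s\<close>, so the triangle inequality averages the
  \<open>\<epsilon>s s\<close>.\<close>

lemma block_encoding_lcu_mat:
  assumes P: "P \<in> carrier_mat (2 ^ n) (2 ^ n)"
    and enc: "\<And>s. s \<in> {1..l} \<Longrightarrow> block_encoding n P (\<alpha>s s) t (\<epsilon>s s) (Ws s) (L s)"
    and \<alpha>: "0 < \<alpha>" and sel: "selector_labels a l sel" and prep: "prep_unitary a l sel \<Omega> \<alpha>s \<alpha> U"
    and \<phi>: "\<And>s. s \<in> {1..l} \<Longrightarrow> complex_of_real (\<Omega> s) = complex_of_real \<bar>\<Omega> s\<bar> * cis (\<phi> s)"
  shows "block_encoding n P \<alpha> (a + t) ((1 / \<alpha>) * (\<Sum>s = 1..l. \<bar>\<Omega> s\<bar> * \<alpha>s s * \<epsilon>s s))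
    (lcu_mat a (t + n) l sel \<phi> Ws U) (lincomb_mat (2 ^ n) l \<Omega> L)"
proof -
  let ?W = "lcu_mat a (t + n) l sel \<phi> Ws U"
  let ?B = "\<lambda>s. ancilla_block n t (Ws s) - complex_of_real (1 / \<alpha>s s) \<cdot>\<^sub>m L s"
  let ?c = "\<lambda>s. \<Omega> s * \<alpha>s s / \<alpha>"
  have pos: "0 < \<alpha>s s" "0 \<le> \<epsilon>s s" and W: "unitary_mat (2 ^ (t + n)) (Ws s)"
    and L: "L s \<in> carrier_mat (2 ^ n) (2 ^ n)" and op: "opnorm (P * ?B s * P) \<le> \<epsilon>s s"
    if "s \<in> {1..l}" for s
    using enc[OF that] by (auto simp: block_encoding_def)
  have unit: "unitary_mat (2 ^ (a + t + n)) ?W"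
    using prep W unitary_lcu_mat[of a U l "t + n" Ws] by (auto simp: prep_unitary_def add.assoc)
  have B: "?B s \<in> carrier_mat (2 ^ n) (2 ^ n)" if "s \<in> {1..l}" for s
    using L[OF that] by auto
  \<comment> \<open>The zero selector state leaves a corner of size \<open>2 ^ (t + n)\<close>, of
    which the zero state of the \<open>t\<close> shared ancillas retains the first
    \<open>2 ^ n\<close> indices.\<close>
  have le: "(2 :: nat) ^ n \<le> 2 ^ (t + n)" by simp
  have "ancilla_block n (a + t) ?W - complex_of_real (1 / \<alpha>) \<cdot>\<^sub>m lincomb_mat (2 ^ n) l \<Omega> L =
      lincomb_mat (2 ^ n) l ?c ?B"
  proof (intro eq_matI)
    fix i j
    assume "i < dim_row (lincomb_mat (2 ^ n) l ?c ?B)" "j < dim_col (lincomb_mat (2 ^ n) l ?c ?B)"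
    then have i: "i < 2 ^ n" and j: "j < 2 ^ n" by (auto simp: lincomb_mat_def)
    have "ancilla_block n (a + t) ?W $$ (i, j) = ?W $$ (i, j)"
      using unitary_matD(1)[OF unit] i j by (rule index_ancilla_block)
    also have "\<dots> = (\<Sum>s = 1..l. complex_of_real (?c s) * Ws s $$ (i, j))"
      using sel prep W \<phi> less_imp_le[OF pos(1)] \<alpha> less_le_trans[OF i le] less_le_trans[OF j le]
      by (rule index_lcu_mat)
    finally have "(ancilla_block n (a + t) ?W - complex_of_real (1 / \<alpha>) \<cdot>\<^sub>m lincomb_mat (2 ^ n) l \<Omega> L) $$ (i, j) =
        (\<Sum>s = 1..l. complex_of_real (?c s) * Ws s $$ (i, j) -
          complex_of_real (1 / \<alpha>) * (complex_of_real (\<Omega> s) * L s $$ (i, j)))"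
      using i j by (simp add: lincomb_mat_def sum_subtractf sum_distrib_left
        carrier_matD[OF ancilla_block_carrier])
    also have "\<dots> = (\<Sum>s = 1..l. complex_of_real (?c s) * ?B s $$ (i, j))"
    proof (intro sum.cong refl)
      fix s assume s: "s \<in> {1..l}"
      have "?B s $$ (i, j) = Ws s $$ (i, j) - complex_of_real (1 / \<alpha>s s) * L s $$ (i, j)"
        using L[OF s] i j index_ancilla_block[OF unitary_matD(1)[OF W[OF s]] i j] by simp
      \<comment> \<open>Since \<open>\<alpha>s s\<close> is positive,
        \<open>?c s / \<alpha>s s\<close> equals \<open>\<Omega> s / \<alpha>\<close>, the
        coefficient of \<open>L s\<close> in the rescaled target.\<close>
      then show "complex_of_real (?c s) * Ws s $$ (i, j) -
          complex_of_real (1 / \<alpha>) * (complex_of_real (\<Omega> s) * L s $$ (i, j)) =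
          complex_of_real (?c s) * ?B s $$ (i, j)"
        using pos(1)[OF s] by (simp add: right_diff_distrib)
    qed
    also have "\<dots> = lincomb_mat (2 ^ n) l ?c ?B $$ (i, j)"
      using i j by (simp add: lincomb_mat_def)
    finally show "(ancilla_block n (a + t) ?W - complex_of_real (1 / \<alpha>) \<cdot>\<^sub>m lincomb_mat (2 ^ n) l \<Omega> L) $$ (i, j) =
      lincomb_mat (2 ^ n) l ?c ?B $$ (i, j)" .
  qed (auto simp: lincomb_mat_def)
  then have "opnorm (P * (ancilla_block n (a + t) ?W -
        complex_of_real (1 / \<alpha>) \<cdot>\<^sub>m lincomb_mat (2 ^ n) l \<Omega> L) * P) =
      opnorm (lincomb_mat (2 ^ n) l ?c (\<lambda>s. P * ?B s * P))"
    using B P by (subst lincomb_mat_sandwich[symmetric]) auto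
  also have "\<dots> \<le> (\<Sum>s = 1..l. \<bar>?c s\<bar> * opnorm (P * ?B s * P))"
    using B P by (intro opnorm_lincomb_mat mult_carrier_mat[of _ _ "2 ^ n"]) auto
  also have "\<dots> \<le> (\<Sum>s = 1..l. \<bar>?c s\<bar> * \<epsilon>s s)"
    using op by (intro sum_mono mult_left_mono) auto
  \<comment> \<open>Positivity of \<open>\<alpha>s s\<close> and \<open>\<alpha>\<close> leaves the
    absolute value on \<open>\<Omega> s\<close> alone.\<close>
  also have "\<dots> = (1 / \<alpha>) * (\<Sum>s = 1..l. \<bar>\<Omega> s\<bar> * \<alpha>s s * \<epsilon>s s)"
    using pos(1) \<alpha> by (auto simp: sum_distrib_left abs_mult abs_of_pos intro!: sum.cong)
  finally have err: "opnorm (P * (ancilla_block n (a + t) ?W -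
        complex_of_real (1 / \<alpha>) \<cdot>\<^sub>m lincomb_mat (2 ^ n) l \<Omega> L) * P) \<le>
      (1 / \<alpha>) * (\<Sum>s = 1..l. \<bar>\<Omega> s\<bar> * \<alpha>s s * \<epsilon>s s)" .
  \<comment> \<open>A block encoding also requires a nonnegative error parameter.\<close>
  have "0 \<le> \<bar>\<Omega> s\<bar> * \<alpha>s s * \<epsilon>s s" if "s \<in> {1..l}" for s
    using pos[OF that] by simp
  then have "0 \<le> (\<Sum>s = 1..l. \<bar>\<Omega> s\<bar> * \<alpha>s s * \<epsilon>s s)"
    by (rule sum_nonneg)
  then have "0 \<le> (1 / \<alpha>) * (\<Sum>s = 1..l. \<bar>\<Omega> s\<bar> * \<alpha>s s * \<epsilon>s s)"
    using \<alpha> by simp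
  then show ?thesis
    unfolding block_encoding_def by (intro conjI lincomb_mat_carrier \<alpha> unit err)
qed

lemma implements_lcu_mat:
  assumes G: "gate_set G" and prep: "implements G a Cprep U"
    and inj: "inj_on sel {1..l}" and W: "\<And>s. s \<in> {1..l} \<Longrightarrow> unitary_mat (2 ^ b) (W s)"
    and ctrl: "\<And>s. s \<in> {1..l} \<Longrightarrow> implements G (a + b) (Cs s) (controlled a (sel s) (\<phi> s) (W s))"
  shows "implements G (a + b) ((Cprep @ concat (map Cs [1..<Suc l])) @ adjoint_circuit Cprep)
    (lcu_mat a b l sel \<phi> W U)"
proof -
  let ?K = "kron U (1\<^sub>m (2 ^ b))"
  let ?S = "block_diag (2 ^ a) (2 ^ b) (select_block (2 ^ b) sel (\<lambda>s. cis (\<phi> s) \<cdot>\<^sub>m W s) l)"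
  have K: "implements G (a + b) Cprep ?K"
    using prep by (rule implements_lift)
  have "implements G (a + b) (Cprep @ concat (map Cs [1..<Suc l])) (?S * ?K)"
    by (rule implements_append[OF K implements_select]) (use inj W ctrl in auto)
  then have "implements G (a + b) ((Cprep @ concat (map Cs [1..<Suc l])) @ adjoint_circuit Cprep)
      (mat_adjoint ?K * (?S * ?K))"
    by (rule implements_append) (rule implements_adjoint[OF G K])
  moreover have "?K \<in> carrier_mat (2 ^ (a + b)) (2 ^ (a + b))"
    using K circuit_mat_carrier[of "a + b" Cprep] by (simp add: implements_def)
  ultimately show ?thesis
    unfolding lcu_mat_def by (subst assoc_mult_mat[of _ "2 ^ (a + b)" "2 ^ (a + b)" _ "2 ^ (a + b)" _ "2 ^ (a + b)"])
      (auto simp: power_add)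
qed

section \<open>Depth and size of the selector register\<close>

lemma depth_lcu_circuit:
  "depth ((Cprep @ concat (map Cs [1..<Suc l])) @ adjoint_circuit Cprep) =
    2 * depth Cprep + (\<Sum>s = 1..l. depth (Cs s))"
proof -
  have "length (concat (map Cs [1..<Suc l])) = (\<Sum>s = 1..l. length (Cs s))"
    by (induction l) auto
  then show ?thesis by (simp add: depth_def adjoint_circuit_def)
qed

text \<open>Gives the selector register room for \<open>l\<close> distinct labels.\<close>

lemma le_two_power_log:
  assumes "1 \<le> l"
  shows "l \<le> 2 ^ nat \<lceil>log 2 (real l)\<rceil>"
proof -
  have "real l = 2 powr log 2 (real l)" using assms by simp
  also have "\<dots> \<le> 2 powr real (nat \<lceil>log 2 (real l)\<rceil>)"
    by (intro powr_mono real_nat_ceiling_ge) simp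
  finally have "real l \<le> real (2 ^ nat \<lceil>log 2 (real l)\<rceil>)" by (simp add: powr_realpow)
  then show ?thesis by (simp only: of_nat_le_iff)
qed

theorem theorem1:
  shows "\<exists>K :: real. K > 0 \<and>
    (\<forall>(n :: nat) (S :: complex vec set) (P :: complex mat) (l :: nat) (t :: nat) (aH :: nat)
      (L :: nat \<Rightarrow> complex mat) (\<Omega> :: nat \<Rightarrow> real) (Ws :: nat \<Rightarrow> complex mat)
      (\<alpha>s :: nat \<Rightarrow> real) (\<epsilon>s :: nat \<Rightarrow> real) (\<alpha> :: real) (\<epsilon> :: real) (H :: complex mat).
      orth_projector_onto (2 ^ n) S P \<longrightarrow>
      l \<ge> 1 \<longrightarrow>
      (\<forall>s \<in> {1..l}. L s \<in> carrier_mat (2 ^ n) (2 ^ n)) \<longrightarrow>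
      H = lincomb_mat (2 ^ n) l \<Omega> L \<longrightarrow>
      (\<forall>s \<in> {1..l}. block_encoding n P (\<alpha>s s) t (\<epsilon>s s) (Ws s) (L s)) \<longrightarrow>
      \<alpha> = (\<Sum>s = 1..l. \<bar>\<Omega> s\<bar> * \<alpha>s s) \<longrightarrow>
      \<epsilon> = (1 / \<alpha>) * (\<Sum>s = 1..l. \<bar>\<Omega> s\<bar> * \<alpha>s s * \<epsilon>s s) \<longrightarrow>
      aH = nat \<lceil>log 2 (real l)\<rceil> \<longrightarrow>
      \<alpha> > 0 \<longrightarrow>
      (\<exists>W. block_encoding n P \<alpha> (aH + t) \<epsilon> W H) \<and>
      (\<forall>sel \<phi> Uprep.
        selector_labels aH l sel \<longrightarrow>
        (\<forall>s \<in> {1..l}. complex_of_real (\<Omega> s) = complex_of_real \<bar>\<Omega> s\<bar> * cis (\<phi> s)) \<longrightarrow>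
        prep_unitary aH l sel \<Omega> \<alpha>s \<alpha> Uprep \<longrightarrow>
        (\<exists>W. block_encoding n P \<alpha> (aH + t) \<epsilon> W H \<and>
          (\<forall>G Cprep Cs.
            gate_set G \<longrightarrow>
            implements G aH Cprep Uprep \<longrightarrow>
            (\<forall>s \<in> {1..l}.
              implements G (aH + t + n) (Cs s) (controlled aH (sel s) (\<phi> s) (Ws s))) \<longrightarrow>
            (\<exists>C. implements G (aH + t + n) C W \<and>
              real (depth C) \<le> K * real (depth Cprep + (\<Sum>s = 1..l. depth (Cs s))))))))"
proof (rule exI[of _ 2], safe)
  fix n t l :: nat and S P L Ws and \<Omega> \<alpha>s \<epsilon>s :: "nat \<Rightarrow> real"
  let ?a = "nat \<lceil>log 2 (real l)\<rceil>" and ?\<alpha> = "\<Sum>s = 1..l. \<bar>\<Omega> s\<bar> * \<alpha>s s"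
  let ?\<epsilon> = "(1 / ?\<alpha>) * (\<Sum>s = 1..l. \<bar>\<Omega> s\<bar> * \<alpha>s s * \<epsilon>s s)" and ?H = "lincomb_mat (2 ^ n) l \<Omega> L"
  assume proj: "orth_projector_onto (2 ^ n) S P" and l: "1 \<le> l"
    and enc: "\<forall>s\<in>{1..l}. block_encoding n P (\<alpha>s s) t (\<epsilon>s s) (Ws s) (L s)" and \<alpha>: "0 < ?\<alpha>"
  have P: "P \<in> carrier_mat (2 ^ n) (2 ^ n)"
    using proj by (simp add: orth_projector_onto_def)
  have \<alpha>s: "0 \<le> \<alpha>s s" and W: "unitary_mat (2 ^ (t + n)) (Ws s)" if "s \<in> {1..l}" for s
    using enc that by (auto simp: block_encoding_def intro: less_imp_le)
  \<comment> \<open>Kept general in labels, phases and preparation: the bare existence claim chooses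
    them, whereas the circuit claim receives them as given.\<close>
  have lcu: "block_encoding n P ?\<alpha> (?a + t) ?\<epsilon> (lcu_mat ?a (t + n) l sel \<phi> Ws U) ?H"
    if "selector_labels ?a l sel" "prep_unitary ?a l sel \<Omega> \<alpha>s ?\<alpha> U"
      "\<forall>s\<in>{1..l}. complex_of_real (\<Omega> s) = complex_of_real \<bar>\<Omega> s\<bar> * cis (\<phi> s)" for sel \<phi> U
    using P enc \<alpha> that by (intro block_encoding_lcu_mat) auto

  show "\<exists>W. block_encoding n P ?\<alpha> (?a + t) ?\<epsilon> W ?H"
  proof -
    \<comment> \<open>Labels start at 1 and basis states at 0, hence the shift.\<close>
    have sel: "selector_labels ?a l (\<lambda>s. s - 1)"
      using le_two_power_log[OF l] by (auto simp: selector_labels_def inj_on_def)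
    obtain U where "prep_unitary ?a l (\<lambda>s. s - 1) \<Omega> \<alpha>s ?\<alpha> U"
      using ex_prep_unitary[OF sel \<alpha>s refl \<alpha>] by blast
    \<comment> \<open>A real coefficient has phase 0 or pi according to its sign.\<close>
    moreover have "\<forall>s\<in>{1..l}. complex_of_real (\<Omega> s) =
        complex_of_real \<bar>\<Omega> s\<bar> * cis (if 0 \<le> \<Omega> s then 0 else pi)"
      by simp
    ultimately have "block_encoding n P ?\<alpha> (?a + t) ?\<epsilon>
        (lcu_mat ?a (t + n) l (\<lambda>s. s - 1) (\<lambda>s. if 0 \<le> \<Omega> s then 0 else pi) Ws U) ?H"
      by (rule lcu[OF sel])
    then show ?thesis by (rule exI)
  qed

  fix sel \<phi> Uprep
  assume sel: "selector_labels ?a l sel"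
    and \<phi>: "\<forall>s\<in>{1..l}. complex_of_real (\<Omega> s) = complex_of_real \<bar>\<Omega> s\<bar> * cis (\<phi> s)"
    and prep: "prep_unitary ?a l sel \<Omega> \<alpha>s ?\<alpha> Uprep"
  have "\<exists>C. implements G (?a + t + n) C (lcu_mat ?a (t + n) l sel \<phi> Ws Uprep) \<and>
      real (depth C) \<le> 2 * real (depth Cprep + (\<Sum>s = 1..l. depth (Cs s)))"
    if "gate_set G" "implements G ?a Cprep Uprep"
      "\<forall>s\<in>{1..l}. implements G (?a + t + n) (Cs s) (controlled ?a (sel s) (\<phi> s) (Ws s))"
    for G Cprep Cs
  proof (intro exI conjI)
    show "implements G (?a + t + n) ((Cprep @ concat (map Cs [1..<Suc l])) @ adjoint_circuit Cprep)
        (lcu_mat ?a (t + n) l sel \<phi> Ws Uprep)"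
      \<comment> \<open>Ancillas and system are read as one register of \<open>t + n\<close> qubits
        behind the selector.\<close>
      unfolding add.assoc
      by (rule implements_lcu_mat) (use that sel W in \<open>auto simp: selector_labels_def add.assoc\<close>)
    show "real (depth ((Cprep @ concat (map Cs [1..<Suc l])) @ adjoint_circuit Cprep)) \<le>
        2 * real (depth Cprep + (\<Sum>s = 1..l. depth (Cs s)))"
      unfolding depth_lcu_circuit by (simp add: sum_nonneg)
  qed
  \<comment> \<open>The witness depends on labels, phases and \<open>Uprep\<close> but on no
    circuit, so one \<open>W\<close> serves every gate set and every choice of
    implementations.\<close>
  then show "\<exists>W. block_encoding n P ?\<alpha> (?a + t) ?\<epsilon> W ?H \<and>
      (\<forall>G Cprep Cs. gate_set G \<longrightarrow> implements G ?a Cprep Uprep \<longrightarrow>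
        (\<forall>s\<in>{1..l}. implements G (?a + t + n) (Cs s) (controlled ?a (sel s) (\<phi> s) (Ws s))) \<longrightarrow>
        (\<exists>C. implements G (?a + t + n) C W \<and>
          real (depth C) \<le> 2 * real (depth Cprep + (\<Sum>s = 1..l. depth (Cs s)))))"
    by (intro exI[of _ "lcu_mat ?a (t + n) l sel \<phi> Ws Uprep"] conjI lcu[OF sel prep \<phi>] allI impI)
qed simp

end
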